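(* Let $d\ge 1$ be fixed and let $\{\mathbf{X}^{(n)}\}_{n\ge1}$ be a sequence of random vectors in $\mathbb{Z}^d$ with nonnegative coordinates, each taking values in a bounded set, such that for each $n$ the $d$-variate probability generating polynomial of $\mathbf{X}^{(n)}$ is real stable and has degree at most $M_n$ in each variable. Let $A_n$ be the covariance matrix of $\mathbf{X}^{(n)}$. Suppose there are a sequence $s_n\to\infty$ and a fixed $d\times d$ matrix $A$ such that $s_n^{-2}A_n\to A$ and $s_n^{-1}M_n^{1/3}\to0$ as $n\to\infty$. Then $$\frac{\mathbf{X}^{(n)}-\mathbb{E}\mathbf{X}^{(n)}}{s_n}\to N(0,A)$$ in distribution as $n\to\infty$.
   Context: The probability generating polynomial of a bounded random vector $\mathbf{X}=(X_1,\dots,X_d)$ of nonnegative integers is $f(z_1,\dots,z_d)=\sum_{\mathbf r}\mathbb{P}(\mathbf X=\mathbf r)z_1^{r_1}\cdots z_d^{r_d}$. A polynomial $f$ in $d$ complex variables with real coefficients is real stable if it has no zeros in $\mathbb{H}^d$, where $\mathbb{H}=\{z\in\mathbb{C}:\Im z>0\}$ is the open upper half plane. $N(0,A)$ denotes the centered Gaussian law with covariance matrix $A$, which may be degenerate. *)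

theory Defs
  imports "HOL-Probability.Probability" "HOL-Library.Poly_Mapping"
begin

text \<open>A real polynomial in variables indexed by the finite type \<open>'d\<close> is the finitely supported
  map from exponent vectors to coefficients; it is evaluated at complex points.\<close>

type_synonym 'd real_mpoly = "(nat ^ 'd) \<Rightarrow>\<^sub>0 real"

definition mpoly_eval :: "('d::finite) real_mpoly \<Rightarrow> complex ^ 'd \<Rightarrow> complex" where
  "mpoly_eval f z =
     (\<Sum>r\<in>Poly_Mapping.keys f. of_real (Poly_Mapping.lookup f r) * (\<Prod>i\<in>UNIV. (z $ i) ^ (r $ i)))"

definition degree_in :: "'d::finite \<Rightarrow> 'd real_mpoly \<Rightarrow> nat" where
  "degree_in i f = Max (insert 0 ((\<lambda>r. r $ i) ` Poly_Mapping.keys f))"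

definition real_stable :: "('d::finite) real_mpoly \<Rightarrow> bool" where
  "real_stable f \<longleftrightarrow> (\<forall>z. (\<forall>i. Im (z $ i) > 0) \<longrightarrow> mpoly_eval f z \<noteq> 0)"

definition bounded_nat_random_vector :: "'a measure \<Rightarrow> ('a \<Rightarrow> nat ^ ('d::finite)) \<Rightarrow> bool" where
  "bounded_nat_random_vector M X \<longleftrightarrow>
     X \<in> measurable M (count_space UNIV) \<and> (\<exists>B. \<forall>\<omega>\<in>space M. \<forall>i. X \<omega> $ i \<le> B)"

text \<open>\<open>Abs_poly_mapping\<close> is only meaningful on finitely supported functions; for bounded \<open>X\<close> this
  is the case, see \<open>lookup_gen_poly\<close>.\<close>

definition gen_poly :: "'a measure \<Rightarrow> ('a \<Rightarrow> nat ^ ('d::finite)) \<Rightarrow> 'd real_mpoly" where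
  "gen_poly M X = Abs_poly_mapping (\<lambda>r. measure M {\<omega> \<in> space M. X \<omega> = r})"

lemma finite_bounded_nat_vectors: "finite {r :: nat ^ ('d::finite). \<forall>i. r $ i \<le> B}"
proof -
  have "finite (vec_nth ` {r :: nat ^ 'd. \<forall>i. r $ i \<le> B})"
  proof (rule finite_subset)
    show "vec_nth ` {r :: nat ^ 'd. \<forall>i. r $ i \<le> B} \<subseteq> PiE UNIV (\<lambda>_. {..B})"
      by auto
    show "finite (PiE (UNIV :: 'd set) (\<lambda>_. {..B}))"
      by (intro finite_PiE) auto
  qed
  then show ?thesis
    by (rule finite_imageD) (auto simp: inj_on_def vec_eq_iff)
qed

lemma lookup_gen_poly:
  assumes "bounded_nat_random_vector M X"
  shows "Poly_Mapping.lookup (gen_poly M X) r = measure M {\<omega> \<in> space M. X \<omega> = r}"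
proof -
  obtain B where B: "\<forall>\<omega>\<in>space M. \<forall>i. X \<omega> $ i \<le> B"
    using assms by (auto simp: bounded_nat_random_vector_def)
  have "{r. measure M {\<omega> \<in> space M. X \<omega> = r} \<noteq> 0} \<subseteq> {r. \<forall>i. r $ i \<le> B}"
  proof
    fix r assume "r \<in> {r. measure M {\<omega> \<in> space M. X \<omega> = r} \<noteq> 0}"
    then have "{\<omega> \<in> space M. X \<omega> = r} \<noteq> {}"
      by force
    then show "r \<in> {r. \<forall>i. r $ i \<le> B}"
      using B by auto
  qed
  then have "finite {r. measure M {\<omega> \<in> space M. X \<omega> = r} \<noteq> 0}"
    using finite_bounded_nat_vectors finite_subset by blast
  then show ?thesis
    by (simp add: gen_poly_def Abs_poly_mapping_inverse)
qed

definition real_vec :: "nat ^ ('d::finite) \<Rightarrow> real ^ 'd" where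
  "real_vec r = (\<chi> i. real (r $ i))"

definition mean_vec :: "'a measure \<Rightarrow> ('a \<Rightarrow> real ^ ('d::finite)) \<Rightarrow> real ^ 'd" where
  "mean_vec M Y = (\<chi> i. LINT \<omega>|M. Y \<omega> $ i)"

definition cov_mat :: "'a measure \<Rightarrow> ('a \<Rightarrow> real ^ ('d::finite)) \<Rightarrow> real ^ 'd ^ 'd" where
  "cov_mat M Y =
     (\<chi> i j. LINT \<omega>|M. (Y \<omega> $ i - mean_vec M Y $ i) * (Y \<omega> $ j - mean_vec M Y $ j))"

definition std_gaussian :: "(real ^ ('d::finite)) measure" where
  "std_gaussian = density lborel (\<lambda>x. ennreal (\<Prod>i\<in>UNIV. std_normal_density (x $ i)))"

text \<open>The possibly degenerate law \<open>N(0, A)\<close> is the law of \<open>B Z\<close>, where \<open>Z\<close> is standard Gaussian and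
  \<open>B\<close> is a square matrix with \<open>B B\<^sup>T = A\<close>. Such a \<open>B\<close> exists exactly when \<open>A\<close> is symmetric positive
  semidefinite, and the law does not depend on its choice; for other \<open>A\<close> the value is meaningless.\<close>

definition centered_gaussian :: "real ^ 'd ^ 'd \<Rightarrow> (real ^ ('d::finite)) measure" where
  "centered_gaussian A =
     distr std_gaussian borel (\<lambda>z. (SOME B :: real ^ 'd ^ 'd. B ** transpose B = A) *v z)"

text \<open>The random variables may live on different probability spaces.\<close>

definition converges_in_distribution ::
    "(nat \<Rightarrow> 'a measure) \<Rightarrow> (nat \<Rightarrow> 'a \<Rightarrow> 'b::topological_space) \<Rightarrow> 'b measure \<Rightarrow> bool" where
  "converges_in_distribution M Y N \<longleftrightarrow>
     (\<forall>f :: 'b \<Rightarrow> real. continuous_on UNIV f \<longrightarrow> bounded (range f) \<longrightarrow>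
        (\<lambda>n. LINT \<omega>|M n. f (Y n \<omega>)) \<longlonglongrightarrow> (LINT y|N. f y))"

end

theory Submission imports Defs "HOL-Computational_Algebra.Fundamental_Theorem_Algebra" "HOL-Complex_Analysis.Great_Picard" begin

text \<open>If \<open>f\<close> is real stable and \<open>a\<close> is a vector of positive integers, the substitution
  \<open>z\<^sub>i = c\<^sub>i z^a\<^sub>i\<close> with \<open>c\<^sub>i > 0\<close> gives a univariate polynomial without zeros in the sector
  \<open>\<bar>arg z\<bar> < \<pi> / max a\<^sub>i\<close>: the open half sectors are mapped into products of half planes, and on
  the positive axis the nonnegative coefficients help. Each linear factor whose root stays away
  from 1 contributes a bounded amount to the third cumulant, so every exponential tilt of
  \<open>a \<bullet> X\<close> has third central moment \<open>O(M)\<close>. Since third central moments are cubic forms,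
  polarisation extends the bound to \<open>m \<bullet> X\<close> with \<open>m\<close> an arbitrary integer vector. This controls
  the third derivative of the logarithmic moment generating function of \<open>m \<bullet> X\<close>, and the
  remainder in Taylor's formula, \<open>O(M / s\<^sup>3)\<close>, tends to 0. So the moment generating functions
  converge on the real axis, hence by Montel's theorem on the complex plane, which yields
  convergence of the characteristic functions at all real multiples of integer vectors; together
  with tightness this implies weak convergence.\<close>

subsection \<open>The third cumulant of a polynomial\<close>

text \<open>The Euler operator \<open>z d/dz\<close>. It multiplies \<open>z^n\<close> by
  \<open>n\<close>, so its iterates evaluated at 1 produce the power moments of the
  exponents.\<close>

definition theta :: "complex poly \<Rightarrow> complex poly" where
  "theta p = [:0, 1:] * pderiv p"

text \<open>\<open>m k\<close> is the k-th moment under the normalised coefficients, and the value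
  is the third derivative of \<open>log p(e^t)\<close> at \<open>t = 0\<close>. Complex polynomials
  are allowed because the linear factors of a generating polynomial need not have real
  coefficients.\<close>

definition poly_cumulant3 :: "complex poly \<Rightarrow> complex" where
  "poly_cumulant3 p =
     (let m = (\<lambda>k. poly ((theta ^^ k) p) 1 / poly p 1) in m 3 - 3 * m 1 * m 2 + 2 * m 1 ^ 3)"

lemma theta_add: "theta (p + q) = theta p + theta q"
  by (simp add: theta_def pderiv_add algebra_simps)

lemma theta_mult: "theta (p * q) = theta p * q + p * theta q"
  by (simp add: theta_def pderiv_mult algebra_simps)

text \<open>Cumulants come from a logarithm, so products become sums. Concretely,
  \<open>theta\<close> is a derivation, and the moments of \<open>p * q\<close> are the binomial
  convolutions of those of \<open>p\<close> and \<open>q\<close>.\<close>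

lemma poly_cumulant3_mult:
  assumes p: "poly p 1 \<noteq> 0" and q: "poly q 1 \<noteq> 0"
  shows "poly_cumulant3 (p * q) = poly_cumulant3 p + poly_cumulant3 q"
proof -
  define a where "a k = poly ((theta ^^ k) p) 1 / poly p 1" for k
  define b where "b k = poly ((theta ^^ k) q) 1 / poly q 1" for k
  have e: "poly (theta p) 1 = a 1 * poly p 1"
    "poly (theta (theta p)) 1 = a 2 * poly p 1" "poly (theta (theta (theta p))) 1 = a 3 * poly p 1"
    using p by (simp_all add: a_def numeral_2_eq_2 numeral_3_eq_3)
  have e': "poly (theta q) 1 = b 1 * poly q 1"
    "poly (theta (theta q)) 1 = b 2 * poly q 1" "poly (theta (theta (theta q))) 1 = b 3 * poly q 1"
    using q by (simp_all add: b_def numeral_2_eq_2 numeral_3_eq_3)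
  have 1: "poly ((theta ^^ 1) (p * q)) 1 / poly (p * q) 1 = a 1 + b 1"
    using p q by (simp add: theta_mult e e' divide_simps) (simp add: algebra_simps)
  have "theta (theta (p * q)) = theta (theta p) * q + 2 * (theta p * theta q) + p * theta (theta q)"
    by (simp only: theta_add theta_mult) (simp add: algebra_simps)
  then have 2: "poly ((theta ^^ 2) (p * q)) 1 / poly (p * q) 1 = a 2 + 2 * a 1 * b 1 + b 2"
    using p q by (simp add: numeral_2_eq_2 e e' divide_simps) (simp add: algebra_simps)
  have "theta (theta (theta (p * q))) = theta (theta (theta p)) * q
      + 3 * (theta (theta p) * theta q) + 3 * (theta p * theta (theta q)) + p * theta (theta (theta q))"
    by (simp only: theta_add theta_mult) (simp add: algebra_simps)
  then have 3: "poly ((theta ^^ 3) (p * q)) 1 / poly (p * q) 1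
      = a 3 + 3 * a 2 * b 1 + 3 * a 1 * b 2 + b 3"
    using p q by (simp add: numeral_3_eq_3 e e' divide_simps) (simp add: algebra_simps)
  show ?thesis
    unfolding poly_cumulant3_def Let_def 1 2 3
    unfolding a_def[symmetric] b_def[symmetric]
    by (simp add: algebra_simps power3_eq_cube)
qed

lemma theta_linear: "(theta ^^ Suc k) [:- c, 1:] = [:0, 1:]"
  by (induction k) (simp_all add: theta_def pderiv_pCons)

lemma poly_cumulant3_linear_le:
  assumes "\<delta> > 0" "\<delta> \<le> cmod (1 - c)"
  shows "cmod (poly_cumulant3 [:- c, 1:]) \<le> 1 / \<delta> + 3 / \<delta>\<^sup>2 + 2 / \<delta> ^ 3"
proof -
  \<comment> \<open>Every moment of positive order of a monic linear polynomial equals this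
    \<open>t\<close>, because \<open>theta\<close> sends it to the fixed polynomial
    \<open>[:0, 1:]\<close>.\<close>
  define t where "t = 1 / (1 - c)"
  have t: "cmod t \<le> 1 / \<delta>"
    using assms by (simp add: t_def norm_divide frac_le)
  have th: "poly ((theta ^^ k) [:- c, 1:]) 1 = 1" if "k > 0" for k
    using that theta_linear[of "k - 1" c] by simp
  have "poly_cumulant3 [:- c, 1:] = t - 3 * t\<^sup>2 + 2 * t ^ 3"
    by (simp add: poly_cumulant3_def th t_def power2_eq_square del: funpow.simps)
  also have "cmod \<dots> \<le> cmod t + 3 * cmod t ^ 2 + 2 * cmod t ^ 3"
    using norm_triangle_ineq[of "t - 3 * t\<^sup>2" "2 * t ^ 3"] norm_triangle_ineq4[of t "3 * t\<^sup>2"]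
    by (simp add: norm_mult norm_power)
  also have "\<dots> \<le> 1 / \<delta> + 3 * (1 / \<delta>) ^ 2 + 2 * (1 / \<delta>) ^ 3"
    using t by (intro add_mono mult_left_mono power_mono) auto
  finally show ?thesis
    by (simp add: power_divide)
qed

lemma poly_cumulant3_const: "poly_cumulant3 [:c:] = 0"
proof -
  have "(theta ^^ Suc k) [:c:] = 0" for k
    by (induction k) (simp_all add: theta_def pderiv_pCons)
  then have "(theta ^^ k) [:c:] = 0" if "k > 0" for k
    using that by (cases k) (simp_all del: funpow.simps)
  then show ?thesis
    by (simp only: poly_cumulant3_def Let_def) simp
qed

text \<open>Split off one root at a time: each linear factor contributes at most the bound of
  \<open>poly_cumulant3_linear_le\<close>, and the final constant contributes 0.\<close>

lemma poly_cumulant3_le: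
  assumes "\<delta> > 0" "p \<noteq> 0" "\<And>z. poly p z = 0 \<Longrightarrow> \<delta> \<le> cmod (1 - z)"
  shows "cmod (poly_cumulant3 p) \<le> real (degree p) * (1 / \<delta> + 3 / \<delta>\<^sup>2 + 2 / \<delta> ^ 3)"
  using assms(2,3)
proof (induction "degree p" arbitrary: p)
  case 0
  then obtain c where "p = [:c:]"
    by (metis degree_eq_zeroE)
  then show ?case
    by (simp add: poly_cumulant3_const)
next
  case (Suc n)
  then have "\<not> constant (poly p)"
    by (simp add: constant_degree flip: Suc(2))
  from Fundamental_Theorem_Algebra.fundamental_theorem_of_algebra[OF this] obtain c where c: "poly p c = 0" ..
  then have "[:- c, 1:] dvd p"
    by (simp add: poly_eq_0_iff_dvd)
  then obtain q where q: "p = [:- c, 1:] * q" ..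
  with Suc.prems have "q \<noteq> 0"
    by auto
  then have "degree p = Suc (degree q)"
    unfolding q using \<open>q \<noteq> 0\<close> by (subst degree_mult_eq) auto
  with Suc(2) have dq: "n = degree q"
    by simp
  have 1: "poly p 1 \<noteq> 0"
    using Suc.prems(2)[of 1] assms(1) by auto
  have root: "\<delta> \<le> cmod (1 - z)" if "poly q z = 0" for z
    using that Suc.prems(2)[of z] by (simp add: q)
  have "poly_cumulant3 p = poly_cumulant3 [:- c, 1:] + poly_cumulant3 q"
    unfolding q by (rule poly_cumulant3_mult) (use 1 in \<open>auto simp: q\<close>)
  also have "cmod \<dots> \<le> (1 / \<delta> + 3 / \<delta>\<^sup>2 + 2 / \<delta> ^ 3)
      + real (degree q) * (1 / \<delta> + 3 / \<delta>\<^sup>2 + 2 / \<delta> ^ 3)"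
    using Suc.prems(2)[OF c] assms(1) Suc(1)[OF dq \<open>q \<noteq> 0\<close> root]
    by (intro order.trans[OF norm_triangle_ineq] add_mono poly_cumulant3_linear_le) auto
  also have "\<dots> = real (degree p) * (1 / \<delta> + 3 / \<delta>\<^sup>2 + 2 / \<delta> ^ 3)"
    unfolding Suc(2)[symmetric] dq[symmetric] by (simp add: distrib_right)
  finally show ?case .
qed

subsection \<open>Third central moments of finite weights\<close>

definition weighted_mean :: "'b set \<Rightarrow> ('b \<Rightarrow> real) \<Rightarrow> ('b \<Rightarrow> real) \<Rightarrow> real" where
  "weighted_mean K W \<phi> = (\<Sum>r\<in>K. W r * \<phi> r) / sum W K"

definition third_central_moment :: "'b set \<Rightarrow> ('b \<Rightarrow> real) \<Rightarrow> ('b \<Rightarrow> real) \<Rightarrow> real" where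
  "third_central_moment K W \<phi> = weighted_mean K W (\<lambda>r. (\<phi> r - weighted_mean K W \<phi>) ^ 3)"

lemma weighted_mean_linear:
  "weighted_mean K W (\<lambda>r. a * \<phi> r + b * \<psi> r) = a * weighted_mean K W \<phi> + b * weighted_mean K W \<psi>"
  by (simp add: weighted_mean_def algebra_simps sum.distrib add_divide_distrib sum_distrib_left)

lemma third_central_moment_eq:
  assumes "sum W K \<noteq> 0"
  shows "third_central_moment K W \<phi> =
     weighted_mean K W (\<lambda>r. \<phi> r ^ 3) - 3 * weighted_mean K W \<phi> * weighted_mean K W (\<lambda>r. (\<phi> r)\<^sup>2)
       + 2 * weighted_mean K W \<phi> ^ 3"
proof -
  define m where "m = weighted_mean K W \<phi>"
  have one: "weighted_mean K W (\<lambda>_. 1) = 1"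
    using assms by (simp add: weighted_mean_def)
  \<comment> \<open>The expanded cube is nested into combinations of two terms, so that
    \<open>weighted_mean_linear\<close> can rewrite it repeatedly.\<close>
  have "third_central_moment K W \<phi> = weighted_mean K W (\<lambda>r. 1 * \<phi> r ^ 3 + (- 3 * m) *
      (1 * (\<phi> r)\<^sup>2 + 1 * ((- m) * \<phi> r + m\<^sup>2 / 3 * 1)))"
    unfolding third_central_moment_def m_def[symmetric]
    by (simp add: power3_eq_cube power2_eq_square algebra_simps)
  also have "\<dots> = weighted_mean K W (\<lambda>r. \<phi> r ^ 3) - 3 * m * weighted_mean K W (\<lambda>r. (\<phi> r)\<^sup>2) + 2 * m ^ 3"
    unfolding weighted_mean_linear one m_def[symmetric]
    by (simp add: power3_eq_cube power2_eq_square algebra_simps)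
  finally show ?thesis
    by (simp add: m_def)
qed

text \<open>Third central moments are cubic forms, so mixed signs reduce to nonnegative combinations.\<close>

lemma third_central_moment_diff:
  "third_central_moment K W (\<lambda>r. p r - q r) =
     4 * third_central_moment K W p - 6 * third_central_moment K W (\<lambda>r. p r + q r)
     + 4 * third_central_moment K W (\<lambda>r. p r + 2 * q r) - third_central_moment K W (\<lambda>r. p r + 3 * q r)"
proof -
  define u where "u r = p r - weighted_mean K W p" for r
  define v where "v r = q r - weighted_mean K W q" for r
  have c: "third_central_moment K W (\<lambda>r. p r + c * q r) = weighted_mean K W (\<lambda>r. (u r + c * v r) ^ 3)" for c
    using weighted_mean_linear[of K W 1 p c q]
    by (simp add: third_central_moment_def u_def v_def algebra_simps)
  \<comment> \<open>The fourth difference of a cubic in \<open>c\<close> vanishes; at the nodes -1,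
    0, 1, 2, 3 this expresses the value at -1 with the coefficients 4, -6, 4, -1.\<close>
  have "(\<lambda>r. (u r + (- 1) * v r) ^ 3) = (\<lambda>r. 4 * (u r + 0 * v r) ^ 3 + 1 *
     ((- 6) * (u r + 1 * v r) ^ 3 + 1 * (4 * (u r + 2 * v r) ^ 3 + (- 1) * (u r + 3 * v r) ^ 3)))"
    by (rule ext) (simp add: power3_eq_cube algebra_simps)
  then have "weighted_mean K W (\<lambda>r. (u r + (- 1) * v r) ^ 3) =
     4 * weighted_mean K W (\<lambda>r. (u r + 0 * v r) ^ 3) + 1 * ((- 6) * weighted_mean K W (\<lambda>r. (u r + 1 * v r) ^ 3)
      + 1 * (4 * weighted_mean K W (\<lambda>r. (u r + 2 * v r) ^ 3) + (- 1) * weighted_mean K W (\<lambda>r. (u r + 3 * v r) ^ 3)))"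
    by (simp only: weighted_mean_linear)
  then show ?thesis
    unfolding c[symmetric] by simp
qed

lemma funpow_theta_sum_monom:
  "(theta ^^ k) (\<Sum>r\<in>K. monom (of_real (W r)) (a r)) = (\<Sum>r\<in>K. monom (of_real (W r * real (a r) ^ k)) (a r))"
proof (induction k)
  case (Suc k)
  have t0: "theta 0 = 0"
    by (simp add: theta_def)
  have tm: "theta (monom c n) = monom (c * of_nat n) n" for c n
  proof -
    have "[:0, 1:] = monom (1 :: complex) 1"
      by (simp add: monom_Suc)
    then show ?thesis
      by (cases n) (simp_all add: theta_def pderiv_monom mult_monom mult.commute)
  qed
  have ts: "theta (sum g K) = (\<Sum>r\<in>K. theta (g r))" for g
    by (induction K rule: infinite_finite_induct) (simp_all add: t0 theta_add)
  show ?case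
    by (simp add: Suc ts tm algebra_simps)
qed simp

lemma poly_cumulant3_sum_monom:
  assumes "sum W K \<noteq> 0"
  shows "poly_cumulant3 (\<Sum>r\<in>K. monom (of_real (W r)) (a r)) =
     of_real (third_central_moment K W (\<lambda>r. real (a r)))"
proof -
  have p: "poly (\<Sum>r\<in>K. monom (of_real (V r)) (a r)) 1 = (of_real (sum V K) :: complex)" for V
    by (simp add: poly_sum poly_monom)
  have "poly ((theta ^^ k) (\<Sum>r\<in>K. monom (of_real (W r)) (a r))) 1
       / poly (\<Sum>r\<in>K. monom (of_real (W r)) (a r)) 1 = of_real (weighted_mean K W (\<lambda>r. real (a r) ^ k))" for k
    unfolding funpow_theta_sum_monom p by (simp add: weighted_mean_def)
  then show ?thesis
    by (simp only: poly_cumulant3_def third_central_moment_eq[OF assms] Let_def) simp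
qed

subsection \<open>Zero-free sectors of stable polynomials\<close>

definition dot_nat :: "nat ^ ('d::finite) \<Rightarrow> nat ^ 'd \<Rightarrow> nat" where
  "dot_nat a r = (\<Sum>i\<in>UNIV. a $ i * r $ i)"

text \<open>The coefficients of \<open>f\<close> after replacing \<open>z_i\<close> by
  \<open>exp(w_i) z_i\<close>. This positive rescaling maps the upper half plane to itself, so it is
  compatible with stability.\<close>

definition tilt :: "('d::finite) real_mpoly \<Rightarrow> real ^ 'd \<Rightarrow> nat ^ 'd \<Rightarrow> real" where
  "tilt f w r = Poly_Mapping.lookup f r * exp (w \<bullet> real_vec r)"

lemma mpoly_eval_powers:
  "mpoly_eval f (\<chi> i. of_real (exp (w $ i)) * z ^ (a $ i)) =
     (\<Sum>r\<in>Poly_Mapping.keys f. of_real (tilt f w r) * z ^ dot_nat a r)"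
  by (simp add: mpoly_eval_def tilt_def dot_nat_def real_vec_def inner_vec_def power_mult_distrib
      prod.distrib exp_sum power_sum exp_of_nat2_mult exp_of_real power_mult of_real_prod
      flip: of_real_power power_mult mult.assoc)

lemma tilt_pos:
  assumes "\<And>r. Poly_Mapping.lookup f r \<ge> 0" "r \<in> Poly_Mapping.keys f"
  shows "tilt f w r > 0"
  using assms(1)[of r] assms(2) by (auto simp: tilt_def in_keys_iff)

lemma sector_powers_nonzero:
  fixes a :: "nat ^ ('d::finite)"
  assumes f: "real_stable f" "\<And>r. Poly_Mapping.lookup f r \<ge> 0" "f \<noteq> 0"
    and a: "\<And>i. 0 < a $ i" "\<And>i. real (a $ i) * \<bar>Arg z\<bar> < pi" and z: "z \<noteq> 0"
  shows "(\<Sum>r\<in>Poly_Mapping.keys f. of_real (tilt f w r) * z ^ dot_nat a r) \<noteq> 0" (is "?G z \<noteq> 0")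
proof -
  \<comment> \<open>In the upper half sector the angles \<open>a $ i * Arg z\<close> lie strictly
    between 0 and \<open>pi\<close>, so every substituted coordinate is in the upper half plane. The
    lower half follows by conjugation.\<close>
  have upper: "?G z \<noteq> 0" if "Im z > 0" and arg: "\<And>i. real (a $ i) * \<bar>Arg z\<bar> < pi" for z
  proof -
    have Arg: "0 < Arg z" "Arg z < pi"
      using that Arg_lt_pi[of z] by auto
    have "Im (of_real (exp (w $ i)) * z ^ (a $ i)) > 0" for i
    proof -
      have "z ^ (a $ i) = of_real (cmod z ^ (a $ i)) * cis (real (a $ i) * Arg z)"
        by (metis (no_types, opaque_lifting) Complex.DeMoivre of_real_power power_mult_distrib rcis_cmod_Arg rcis_def)
      moreover have "sin (real (a $ i) * Arg z) > 0"
        using Arg arg[of i] a(1)[of i] by (intro sin_gt_zero) auto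
      moreover have "cmod z > 0"
        using that(1) by auto
      ultimately show ?thesis
        by simp
    qed
    then have "mpoly_eval f (\<chi> i. of_real (exp (w $ i)) * z ^ (a $ i)) \<noteq> 0"
      using f(1) by (simp add: real_stable_def)
    then show ?thesis
      by (simp add: mpoly_eval_powers)
  qed
  consider "Im z > 0" | "Im z < 0" | "Im z = 0"
    by linarith
  then show ?thesis
  proof cases
    case 1
    then show ?thesis
      using upper a by blast
  next
    case 2
    then have "Arg (cnj z) = - Arg z"
      by (subst Arg_cnj) (auto simp: complex_is_Real_iff)
    then have "?G (cnj z) \<noteq> 0"
      using 2 a by (intro upper) auto
    moreover have "?G (cnj z) = cnj (?G z)"
      by simp
    ultimately show ?thesis
      by (metis complex_cnj_zero_iff)
  next
    case 3
    \<comment> \<open>Index types are nonempty, so some exponent \<open>a $ i \<ge> 1\<close>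
      exists. It excludes \<open>Arg z = pi\<close>, and a real \<open>z\<close> in the sector is
      therefore positive.\<close>
    obtain i :: 'd where True by simp
    have "Arg z \<noteq> pi"
      using a(1)[of i] a(2)[of i] by auto
    with 3 have "Re z > 0"
      using Arg_eq_pi[of z] z by (metis complex_eqI zero_complex.sel linorder_less_linear)
    with 3 have z: "z = of_real (Re z)"
      by (simp add: complex_eq_iff)
    have "?G z = of_real (\<Sum>r\<in>Poly_Mapping.keys f. tilt f w r * Re z ^ dot_nat a r)"
      by (subst z) simp
    moreover have "(\<Sum>r\<in>Poly_Mapping.keys f. tilt f w r * Re z ^ dot_nat a r) > 0"
      using f \<open>Re z > 0\<close> by (intro sum_pos) (auto simp: tilt_pos)
    ultimately show ?thesis
      by (simp only: of_real_eq_0_iff)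
  qed
qed

subsection \<open>Third order control of the logarithmic moment generating function\<close>

text \<open>The constant depends on \<open>a\<close> only: the zero-free disc around 1 has a radius
  determined by \<open>a\<close>, and the substituted polynomial has degree at most
  \<open>N * k\<close>, whatever the tilt.\<close>

lemma third_central_moment_tilt_nat_le:
  fixes a :: "nat ^ ('d::finite)"
  assumes a: "\<And>i. 0 < a $ i"
  obtains C where "C \<ge> 0" "\<And>f k w. \<lbrakk>real_stable f; \<And>r. Poly_Mapping.lookup f r \<ge> 0; f \<noteq> 0;
      \<And>i. degree_in i f \<le> k\<rbrakk> \<Longrightarrow>
      \<bar>third_central_moment (Poly_Mapping.keys f) (tilt f w) (\<lambda>r. real (dot_nat a r))\<bar> \<le> C * real k"
proof -
  define N where "N = (\<Sum>i\<in>UNIV. a $ i)"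
  have aN: "a $ i \<le> N" for i
    unfolding N_def by (rule member_le_sum) auto
  \<comment> \<open>Continuity of \<open>Arg\<close> at 1 places a disc around 1 inside the sector
    of half-angle \<open>pi / (N + 1)\<close>, which is narrow enough for every
    \<open>a $ i \<le> N\<close>.\<close>
  have "isCont Arg 1"
    by (rule continuous_at_Arg) auto
  moreover have "pi / (real N + 1) > 0"
    by simp
  ultimately obtain d where d: "d > 0" "\<And>z. dist z 1 < d \<Longrightarrow> dist (Arg z) (Arg 1) < pi / (real N + 1)"
    unfolding continuous_at_eps_delta by metis
  \<comment> \<open>The cap 1 keeps the disc away from \<open>z = 0\<close>, which the sector lemma
    excludes.\<close>
  define \<delta> where "\<delta> = min d 1"
  have \<delta>: "\<delta> > 0"
    using d by (simp add: \<delta>_def)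
  define C0 where "C0 = 1 / \<delta> + 3 / \<delta>\<^sup>2 + 2 / \<delta> ^ 3"
  have C0: "C0 \<ge> 0"
    using \<delta> by (simp add: C0_def)
  have "\<bar>third_central_moment (Poly_Mapping.keys f) (tilt f w) (\<lambda>r. real (dot_nat a r))\<bar> \<le> (real N * C0) * real k"
    if f: "real_stable f" "\<And>r. Poly_Mapping.lookup f r \<ge> 0" "f \<noteq> 0"
      and deg: "\<And>i. degree_in i f \<le> k" for f k w
  proof -
    let ?K = "Poly_Mapping.keys f"
    define G where "G = (\<Sum>r\<in>?K. monom (of_real (tilt f w r) :: complex) (dot_nat a r))"
    have G: "poly G z = (\<Sum>r\<in>?K. of_real (tilt f w r) * z ^ dot_nat a r)" for z
      by (simp add: G_def poly_sum poly_monom)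
    have sum_pos: "sum (tilt f w) ?K > 0"
      using f by (intro sum_pos tilt_pos) auto
    have roots: "\<delta> \<le> cmod (1 - z)" if "poly G z = 0" for z
    proof (rule ccontr)
      assume *: "\<not> \<delta> \<le> cmod (1 - z)"
      then have "z \<noteq> 0"
        by (auto simp: \<delta>_def)
      have "dist z 1 < d"
        using * by (auto simp: \<delta>_def dist_norm norm_minus_commute)
      then have Arg: "\<bar>Arg z\<bar> < pi / (real N + 1)"
        using d(2) by (fastforce simp: dist_real_def)
      have "real (a $ i) * \<bar>Arg z\<bar> < pi" for i
      proof -
        have "real (a $ i) * \<bar>Arg z\<bar> \<le> (real N + 1) * \<bar>Arg z\<bar>"
          using aN[of i] by (intro mult_right_mono) auto
        also have "\<dots> < pi"
          using Arg by (simp add: field_simps)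
        finally show ?thesis .
      qed
      then show False
        using sector_powers_nonzero[OF f a _ \<open>z \<noteq> 0\<close>] that by (simp add: G)
    qed
    have "dot_nat a r \<le> N * k" if "r \<in> ?K" for r
    proof -
      have "r $ i \<le> k" for i
        using deg[of i] that by (auto simp: degree_in_def)
      then show ?thesis
        unfolding dot_nat_def N_def sum_distrib_right by (intro sum_mono mult_left_mono) auto
    qed
    then have "degree G \<le> N * k"
      unfolding G_def by (intro degree_sum_le order.trans[OF degree_monom_le]) auto
    moreover have "G \<noteq> 0"
      using G[of 1] sum_pos by (auto simp flip: of_real_sum)
    moreover from \<open>degree G \<le> N * k\<close> have "real (degree G) \<le> real (N * k)"
      by (simp only: of_nat_le_iff)
    ultimately have "cmod (poly_cumulant3 G) \<le> real (N * k) * C0"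
      unfolding C0_def
      by (intro order.trans[OF poly_cumulant3_le[OF \<delta> _ roots]] mult_right_mono)
         (use \<delta> in auto)
    then show ?thesis
      using sum_pos unfolding G_def by (subst (asm) poly_cumulant3_sum_monom) (auto simp: mult_ac)
  qed
  then show ?thesis
    using C0 by (intro that[of "real N * C0"]) auto
qed

definition int_vec :: "int ^ ('d::finite) \<Rightarrow> real ^ 'd" where
  "int_vec m = (\<chi> i. of_int (m $ i))"

lemma third_central_moment_tilt_int_le:
  fixes m :: "int ^ ('d::finite)"
  obtains C where "C \<ge> 0" "\<And>f k w. \<lbrakk>real_stable f; \<And>r. Poly_Mapping.lookup f r \<ge> 0; f \<noteq> 0;
      \<And>i. degree_in i f \<le> k\<rbrakk> \<Longrightarrow>
      \<bar>third_central_moment (Poly_Mapping.keys f) (tilt f w) (\<lambda>r. int_vec m \<bullet> real_vec r)\<bar> \<le> C * real k"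
proof -
  \<comment> \<open>\<open>m = p - q\<close> with all coordinates of \<open>p\<close> and
    \<open>q\<close> positive. The vectors \<open>c j = p + j q\<close> are then positive too, and
    \<open>j = 0, 1, 2, 3\<close> are the combinations appearing in
    \<open>third_central_moment_diff\<close>.\<close>
  define p :: "nat ^ 'd" where "p = (\<chi> i. nat (\<bar>m $ i\<bar> + m $ i) + 1)"
  define q :: "nat ^ 'd" where "q = (\<chi> i. nat \<bar>m $ i\<bar> + 1)"
  define c :: "nat \<Rightarrow> nat ^ 'd" where "c j = (\<chi> i. p $ i + j * q $ i)" for j
  have "\<exists>C\<ge>0. \<forall>f k w. real_stable f \<longrightarrow> (\<forall>r. Poly_Mapping.lookup f r \<ge> 0) \<longrightarrow> f \<noteq> 0 \<longrightarrow>
      (\<forall>i. degree_in i f \<le> k) \<longrightarrow>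
      \<bar>third_central_moment (Poly_Mapping.keys f) (tilt f w) (\<lambda>r. real (dot_nat (c j) r))\<bar> \<le> C * real k" for j
    by (rule third_central_moment_tilt_nat_le[of "c j"]) (auto simp: c_def p_def)
  then obtain C where C: "\<And>j. C j \<ge> 0" "\<And>j f k w. \<lbrakk>real_stable f; \<forall>r. Poly_Mapping.lookup f r \<ge> 0; f \<noteq> 0;
      \<forall>i. degree_in i f \<le> k\<rbrakk> \<Longrightarrow>
      \<bar>third_central_moment (Poly_Mapping.keys f) (tilt f w) (\<lambda>r. real (dot_nat (c j) r))\<bar> \<le> C j * real k"
    by metis
  have dc: "real (dot_nat (c j) r) = real (dot_nat p r) + real j * real (dot_nat q r)" for j r
    by (simp add: dot_nat_def c_def algebra_simps sum.distrib sum_distrib_left)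
  have dm: "int_vec m \<bullet> real_vec r = real (dot_nat p r) - real (dot_nat q r)" for r
    by (simp add: dot_nat_def p_def q_def int_vec_def real_vec_def inner_vec_def algebra_simps
        sum.distrib flip: sum_subtractf)
  show ?thesis
  proof (rule that[of "4 * C 0 + 6 * C 1 + 4 * C 2 + C 3"])
    fix f :: "'d real_mpoly" and k w
    assume "real_stable f" "\<And>r. Poly_Mapping.lookup f r \<ge> 0" "f \<noteq> 0" "\<And>i. degree_in i f \<le> k"
    then have *: "\<bar>third_central_moment (Poly_Mapping.keys f) (tilt f w) (\<lambda>r. real (dot_nat p r) + real j * real (dot_nat q r))\<bar> \<le> C j * real k" for j
      using C(2)[of f k w j] by (simp add: dc)
    show "\<bar>third_central_moment (Poly_Mapping.keys f) (tilt f w) (\<lambda>r. int_vec m \<bullet> real_vec r)\<bar>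
        \<le> (4 * C 0 + 6 * C 1 + 4 * C 2 + C 3) * real k"
      unfolding dm third_central_moment_diff distrib_right
      using *[of 0] *[of 1] *[of 2] *[of 3] by simp
  qed (use C(1) in auto)
qed

text \<open>Taylor's formula of order 3 for \<open>t \<mapsto> ln (sum (W' t) K)\<close>.
  Differentiating in \<open>t\<close> tilts the weights, so the Lagrange remainder is a third
  central moment under the weights tilted by the intermediate point.\<close>

lemma log_weighted_mgf_taylor:
  fixes W \<phi> :: "'b \<Rightarrow> real"
  assumes K: "finite K" "K \<noteq> {}" and W: "\<And>r. r \<in> K \<Longrightarrow> W r > 0"
  defines "W' \<equiv> \<lambda>t r. W r * exp (t * \<phi> r)"
  obtains \<xi> where "ln (sum (W' t) K) = ln (sum W K) + t * weighted_mean K W \<phi>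
     + t\<^sup>2 / 2 * (weighted_mean K W (\<lambda>r. (\<phi> r)\<^sup>2) - (weighted_mean K W \<phi>)\<^sup>2)
     + t ^ 3 / 6 * third_central_moment K (W' \<xi>) \<phi>"
proof -
  define m where "m k t = (\<Sum>r\<in>K. W' t r * \<phi> r ^ k)" for k t
  have m0: "m 0 t > 0" for t
    unfolding m_def W'_def using K W by (intro sum_pos) auto
  have dm: "(m k has_real_derivative m (Suc k) t) (at t)" for k t
    unfolding m_def[abs_def] W'_def
    by (auto intro!: derivative_eq_intros sum.cong simp: mult_ac)
  \<comment> \<open>\<open>D k\<close> for \<open>k \<le> 3\<close> is the k-th derivative of
    \<open>ln (m 0 t)\<close>: for positive \<open>k\<close>, the k-th cumulant of the tilted
    weights in terms of their moments.\<close>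
  define D where "D k = (if k = 0 then (\<lambda>t. ln (m 0 t))
      else if k = 1 then (\<lambda>t. m 1 t / m 0 t)
      else if k = 2 then (\<lambda>t. m 2 t / m 0 t - (m 1 t / m 0 t)\<^sup>2)
      else (\<lambda>t. m 3 t / m 0 t - 3 * (m 1 t / m 0 t) * (m 2 t / m 0 t) + 2 * (m 1 t / m 0 t) ^ 3))" for k :: nat
  have "(D k has_real_derivative D (Suc k) x) (at x)" if k3: "k < 3" for k x
  proof -
    have nz: "m 0 x \<noteq> 0" and pos: "m 0 x > 0"
      using m0[of x] by auto
    have d0: "(m 0 has_real_derivative m 1 x) (at x)" and d1: "(m 1 has_real_derivative m 2 x) (at x)"
      and d2: "(m 2 has_real_derivative m 3 x) (at x)"
      using dm[of 0 x] dm[of 1 x] dm[of 2 x] by (simp_all add: numeral_2_eq_2 numeral_3_eq_3)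
    consider "k = 0" | "k = 1" | "k = 2"
      using k3 by linarith
    then show ?thesis
    proof cases
      case 1
      have "((\<lambda>t. ln (m 0 t)) has_real_derivative m 1 x / m 0 x) (at x)"
        by (rule derivative_eq_intros d0 pos refl)+ (simp add: field_simps)
      then show ?thesis
        using 1 by (simp add: D_def)
    next
      case 2
      have "((\<lambda>t. m 1 t / m 0 t) has_real_derivative m 2 x / m 0 x - (m 1 x / m 0 x)\<^sup>2) (at x)"
        by (rule derivative_eq_intros d0 d1 nz refl)+ (use nz in \<open>simp add: field_simps power2_eq_square\<close>)
      then show ?thesis
        using 2 by (simp add: D_def)
    next
      case 3
      have "((\<lambda>t. m 2 t / m 0 t - (m 1 t / m 0 t)\<^sup>2) has_real_derivative
         m 3 x / m 0 x - 3 * (m 1 x / m 0 x) * (m 2 x / m 0 x) + 2 * (m 1 x / m 0 x) ^ 3) (at x)"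
        by (rule derivative_eq_intros d0 d1 d2 nz refl)+
           (use nz in \<open>simp add: field_simps power2_eq_square power3_eq_cube\<close>)
      then show ?thesis
        using 3 by (simp add: D_def)
    qed
  qed
  then have "\<exists>\<xi>. \<bar>\<xi>\<bar> \<le> \<bar>t\<bar> \<and> D 0 t = (\<Sum>k<3. D k 0 / fact k * t ^ k) + D 3 \<xi> / fact 3 * t ^ 3"
    by (intro Maclaurin_bi_le) auto
  then obtain \<xi> where \<xi>: "D 0 t = (\<Sum>k<3. D k 0 / fact k * t ^ k) + D 3 \<xi> / fact 3 * t ^ 3"
    by blast
  have wm: "weighted_mean K (W' x) (\<lambda>r. \<phi> r ^ k) = m k x / m 0 x" for k x
    by (simp add: weighted_mean_def m_def)
  have W0: "W' 0 = W"
    by (simp add: W'_def)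
  have sW: "sum (W' x) K = m 0 x" for x
    by (simp add: m_def)
  show ?thesis
  proof (rule that[of \<xi>])
    have 3: "third_central_moment K (W' \<xi>) \<phi> = D 3 \<xi>"
      using m0[of \<xi>] wm[of \<xi> 1] wm[of \<xi> 2] wm[of \<xi> 3]
      by (subst third_central_moment_eq) (simp_all add: sW D_def)
    have "D 0 t = D 0 0 + t * D 1 0 + t\<^sup>2 / 2 * D 2 0 + t ^ 3 / 6 * D 3 \<xi>"
      using \<xi> by (simp add: eval_nat_numeral(3) numeral_2_eq_2 fact_numeral mult.commute lessThan_Suc)
    moreover have "D 1 0 = weighted_mean K W \<phi>"
      using wm[of 0 1] by (simp add: D_def W0)
    moreover have "D 2 0 = weighted_mean K W (\<lambda>r. (\<phi> r)\<^sup>2) - (weighted_mean K W \<phi>)\<^sup>2"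
      using wm[of 0 1] wm[of 0 2] by (simp add: D_def W0)
    moreover have "D 0 t = ln (sum (W' t) K)" "D 0 0 = ln (sum W K)"
      using sW[of t] sW[of 0] by (simp_all add: D_def W0)
    ultimately show "ln (sum (W' t) K) = ln (sum W K) + t * weighted_mean K W \<phi>
     + t\<^sup>2 / 2 * (weighted_mean K W (\<lambda>r. (\<phi> r)\<^sup>2) - (weighted_mean K W \<phi>)\<^sup>2)
     + t ^ 3 / 6 * third_central_moment K (W' \<xi>) \<phi>"
      by (simp only: 3)
  qed
qed

subsection \<open>Factorisation of positive semidefinite matrices\<close>

lemma inner_matrix_vector_add:
  fixes A :: "real ^ ('d::finite) ^ 'd"
  assumes "transpose A = A"
  shows "(x + t *\<^sub>R axis k 1) \<bullet> (A *v (x + t *\<^sub>R axis k 1)) = x \<bullet> (A *v x) + 2 * t * (A *v x) $ k + t\<^sup>2 * A $ k $ k"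
proof -
  have "x \<bullet> (A *v axis k 1) = axis k 1 \<bullet> (A *v x)"
    by (metis assms dot_lmul_matrix inner_commute transpose_matrix_vector)
  moreover have "axis k 1 \<bullet> (A *v axis k 1) = A $ k $ k"
    by (simp add: inner_axis' matrix_vector_mult_basis column_def)
  moreover have "axis k 1 \<bullet> (A *v x) = (A *v x) $ k"
    by (simp add: inner_axis')
  ultimately show ?thesis
    by (simp add: matrix_vector_right_distrib matrix_vector_mult_scaleR inner_add_left inner_add_right
        power2_eq_square algebra_simps)
qed

text \<open>Cholesky elimination, one coordinate at a time. Requiring the columns of the factor
  outside \<open>S\<close> to vanish leaves column \<open>k\<close> free for the next elimination
  step.\<close>

lemma positive_semidefinite_factor_on:
  fixes A :: "real ^ ('d::finite) ^ 'd"
  assumes "finite S" "transpose A = A" "\<And>x. x \<bullet> (A *v x) \<ge> 0" "\<And>i j. A $ i $ j \<noteq> 0 \<Longrightarrow> i \<in> S"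
  shows "\<exists>B. B ** transpose B = A \<and> (\<forall>i j. j \<notin> S \<longrightarrow> B $ i $ j = 0)"
  using assms
proof (induction S arbitrary: A rule: finite_induct)
  case empty
  then have "A $ i $ j = 0" for i j
    by blast
  then have "A = 0"
    by (simp add: vec_eq_iff)
  then show ?case
    by (intro exI[of _ 0]) (simp add: vec_eq_iff matrix_matrix_mult_def)
next
  case (insert k S)
  note sym = insert.prems(1) and psd = insert.prems(2)
  have symm: "A $ i $ j = A $ j $ i" for i j
    using sym by (metis transpose_def vec_lambda_beta)
  have Akk: "A $ k $ k \<ge> 0"
    using psd[of "axis k 1"] by (simp add: inner_axis' matrix_vector_mult_basis column_def)
  show ?case
  proof (cases "A $ k $ k = 0")
    case True
    have "A $ k $ j = 0" for j
    proof (rule ccontr)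
      assume nz: "A $ k $ j \<noteq> 0"
      \<comment> \<open>With a zero pivot the quadratic form at
        \<open>axis j 1 + t *\<^sub>R axis k 1\<close> is affine in \<open>t\<close>; this
        \<open>t\<close> gives it the value -1.\<close>
      define t where "t = - (A $ j $ j + 1) / (2 * A $ k $ j)"
      have "axis j 1 \<bullet> (A *v axis j 1) = A $ j $ j" "(A *v axis j 1) $ k = A $ k $ j"
        by (simp_all add: inner_axis' matrix_vector_mult_basis column_def)
      then have "0 \<le> A $ j $ j + 2 * t * A $ k $ j"
        using psd[of "axis j 1 + t *\<^sub>R axis k 1"] True by (simp add: inner_matrix_vector_add[OF sym])
      also have "\<dots> = - 1"
        using nz by (simp add: t_def field_simps)
      finally show False
        by simp
    qed
    then have "i \<in> S" if "A $ i $ j \<noteq> 0" for i j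
      using insert.prems(3)[of i j] that by auto
    then have "\<exists>B. B ** transpose B = A \<and> (\<forall>i j. j \<notin> S \<longrightarrow> B $ i $ j = 0)"
      by (rule insert.IH[OF sym psd])
    then show ?thesis
      by auto
  next
    case False
    with Akk have pos: "A $ k $ k > 0"
      by simp
    \<comment> \<open>The Cholesky column for the pivot \<open>k\<close>: subtracting the rank-one
      matrix \<open>c $ i * c $ j\<close> clears row and column \<open>k\<close> and leaves the
      Schur complement \<open>A'\<close>.\<close>
    define c where "c = (\<chi> i. A $ i $ k / sqrt (A $ k $ k))"
    define A' where "A' = (\<chi> i j. A $ i $ j - c $ i * c $ j)"
    have cc: "c $ i * c $ j = A $ i $ k * A $ j $ k / A $ k $ k" for i j
      using pos by (simp add: c_def)
    have A'x: "A' *v x = A *v x - (c \<bullet> x) *\<^sub>R c" for x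
      by (simp add: A'_def vec_eq_iff matrix_vector_mult_def inner_vec_def algebra_simps
          sum_subtractf sum_distrib_left sum_distrib_right)
    have sym': "transpose A' = A'"
      by (simp add: A'_def transpose_def vec_eq_iff symm mult.commute)
    have psd': "x \<bullet> (A' *v x) \<ge> 0" for x
    proof -
      \<comment> \<open>The minimiser of the quadratic form of \<open>A\<close> along the line
        through \<open>x\<close> in direction \<open>k\<close>; the minimum is exactly the form of
        \<open>A'\<close> at \<open>x\<close>.\<close>
      define s where "s = - ((A *v x) $ k / A $ k $ k)"
      have "c \<bullet> x = (A *v x) $ k / sqrt (A $ k $ k)"
        by (simp add: c_def inner_vec_def matrix_vector_mult_def sum_divide_distrib,
            intro sum.cong refl, metis symm)
      then have "(c \<bullet> x)\<^sup>2 = ((A *v x) $ k)\<^sup>2 / A $ k $ k"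
        using pos by (simp add: power_divide)
      also have "\<dots> = - (2 * s * (A *v x) $ k + s\<^sup>2 * A $ k $ k)"
        using pos by (simp add: s_def power2_eq_square field_simps)
      also have "\<dots> \<le> x \<bullet> (A *v x)"
        using psd[of "x + s *\<^sub>R axis k 1"] unfolding inner_matrix_vector_add[OF sym] by simp
      finally show ?thesis
        by (simp add: A'x inner_diff_right power2_eq_square inner_commute)
    qed
    have "i \<in> S" if "A' $ i $ j \<noteq> 0" for i j
    proof -
      have "i \<noteq> k"
        using that pos by (auto simp: A'_def cc symm[of j k])
      moreover have "A $ i $ j \<noteq> 0 \<or> A $ i $ k \<noteq> 0"
        using that by (auto simp: A'_def cc)
      ultimately show ?thesis
        using insert.prems(3) by blast
    qed
    then have "\<exists>B. B ** transpose B = A' \<and> (\<forall>i j. j \<notin> S \<longrightarrow> B $ i $ j = 0)"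
      by (rule insert.IH[OF sym' psd'])
    then obtain B' where B': "B' ** transpose B' = A'" "\<And>i j. j \<notin> S \<Longrightarrow> B' $ i $ j = 0"
      by blast
    \<comment> \<open>Column \<open>k\<close> of \<open>B'\<close> is zero since \<open>k\<close> is
      not in \<open>S\<close>, so inserting \<open>c\<close> there adds just the rank-one term
      removed before.\<close>
    define B :: "real ^ 'd ^ 'd" where "B = (\<chi> i j. if j = k then c $ i else B' $ i $ j)"
    have "(B ** transpose B) $ i $ j = A $ i $ j" for i j
    proof -
      have "(B ** transpose B) $ i $ j = (\<Sum>l\<in>UNIV. B $ i $ l * B $ j $ l)"
        by (simp add: matrix_matrix_mult_def transpose_def)
      also have "\<dots> = c $ i * c $ j + (\<Sum>l\<in>UNIV - {k}. B' $ i $ l * B' $ j $ l)"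
        by (subst sum.remove[of _ k]) (auto simp: B_def)
      also have "(\<Sum>l\<in>UNIV - {k}. B' $ i $ l * B' $ j $ l) = (\<Sum>l\<in>UNIV. B' $ i $ l * B' $ j $ l)"
        using B'(2)[of k] insert.hyps by (subst (2) sum.remove[of _ k]) auto
      also have "\<dots> = (B' ** transpose B') $ i $ j"
        by (simp add: matrix_matrix_mult_def transpose_def)
      also have "c $ i * c $ j + \<dots> = A $ i $ j"
        by (simp add: B'(1) A'_def)
      finally show ?thesis .
    qed
    moreover have "B $ i $ j = 0" if "j \<notin> insert k S" for i j
      using that B'(2) by (auto simp: B_def)
    ultimately show ?thesis
      by (intro exI[of _ B]) (simp add: vec_eq_iff)
  qed
qed

lemma positive_semidefinite_factor:
  fixes A :: "real ^ ('d::finite) ^ 'd"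
  assumes "transpose A = A" "\<And>x. x \<bullet> (A *v x) \<ge> 0"
  shows "\<exists>B :: real ^ 'd ^ 'd. B ** transpose B = A"
  using positive_semidefinite_factor_on[of UNIV, OF finite assms] by auto

subsection \<open>Characteristic function of the Gaussian law\<close>

lemma prod_UNIV_axis_eq_prod_Basis:
  fixes x :: "real ^ ('d::finite)"
  shows "(\<Prod>i\<in>UNIV. g (x $ i)) = (\<Prod>b\<in>Basis. g (x \<bullet> b))"
proof -
  have 1: "(Basis :: (real ^ 'd) set) = (\<lambda>i. axis i 1) ` UNIV"
    by (auto simp: Basis_vec_def)
  have 2: "inj (\<lambda>i :: 'd. axis i (1 :: real))"
    by (auto simp: inj_on_def axis_eq_axis)
  show ?thesis
    unfolding 1 prod.reindex[OF 2] by (simp add: inner_axis)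
qed

lemma prob_space_std_gaussian: "prob_space (std_gaussian :: (real ^ ('d::finite)) measure)"
proof
  have 1: "(\<integral>\<^sup>+t. ennreal (std_normal_density t) \<partial>lborel) = 1"
    using prob_space.emeasure_space_1[OF prob_space_normal_density[of 1 0]]
    by (simp add: emeasure_density)
  have "emeasure std_gaussian (space (std_gaussian :: (real ^ 'd) measure)) =
      (\<integral>\<^sup>+x. (\<Prod>b\<in>Basis. ennreal (std_normal_density (x \<bullet> b))) \<partial>(lborel :: (real ^ 'd) measure))"
    unfolding std_gaussian_def prod_UNIV_axis_eq_prod_Basis
    by (subst emeasure_density) (auto simp: prod_ennreal)
  also have "\<dots> = 1"
    by (subst nn_integral_lborel_prod) (simp_all add: 1)
  finally show "emeasure std_gaussian (space (std_gaussian :: (real ^ 'd) measure)) = 1" .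
qed

text \<open>Fubini: Lebesgue measure is the image of the product of its coordinate measures, and the
  Gaussian density splits into factors. The bound on \<open>g\<close> makes each factor
  integrable.\<close>

lemma integral_std_gaussian_prod:
  fixes g :: "real ^ ('d::finite) \<Rightarrow> real \<Rightarrow> complex"
  assumes [measurable]: "\<And>b. g b \<in> borel_measurable borel" and bd: "\<And>b t. norm (g b t) \<le> 1"
  shows "(LINT x|std_gaussian. (\<Prod>b\<in>Basis. g b (x \<bullet> b))) =
     (\<Prod>b\<in>Basis. LINT t|std_normal_distribution. g b t)"
proof -
  define h where "h b t = std_normal_density t *\<^sub>R g b t" for b t
  interpret product_sigma_finite "\<lambda>_ :: real ^ 'd. lborel :: real measure"
    by standard
  have int: "integrable lborel (h b)" for b
  proof -
    have "integrable lborel std_normal_density"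
      by (rule integrable_normal_density) simp
    then show ?thesis
      by (rule Bochner_Integration.integrable_bound)
         (auto simp: h_def[abs_def] intro!: mult_left_le bd)
  qed
  have "(LINT x|std_gaussian. (\<Prod>b\<in>Basis. g b (x \<bullet> b))) =
     (LINT x|lborel. (\<Prod>b\<in>Basis. std_normal_density (x \<bullet> b)) *\<^sub>R (\<Prod>b\<in>Basis. g b (x \<bullet> b)))"
    unfolding std_gaussian_def prod_UNIV_axis_eq_prod_Basis
    by (subst integral_density) (auto intro!: prod_nonneg)
  also have "\<dots> = (LINT x|lborel. (\<Prod>b\<in>Basis. h b (x \<bullet> b)))"
    by (simp add: h_def scaleR_conv_of_real prod.distrib)
  also have "\<dots> = (LINT f|(\<Pi>\<^sub>M b\<in>Basis. lborel). (\<Prod>b\<in>Basis. h b ((\<Sum>b\<in>Basis. f b *\<^sub>R b :: real ^ 'd) \<bullet> b)))"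
    unfolding lborel_eq[where 'a="real ^ 'd"] h_def by (subst integral_distr) auto
  also have "\<dots> = (LINT f|(\<Pi>\<^sub>M b\<in>(Basis :: (real ^ 'd) set). lborel). (\<Prod>b\<in>Basis. h b (f b)))"
    by (intro Bochner_Integration.integral_cong prod.cong) (auto simp: inner_sum_left_Basis)
  also have "\<dots> = (\<Prod>b\<in>Basis. LINT t|lborel. h b t)"
    by (rule product_integral_prod) (auto simp: int)
  also have "\<dots> = (\<Prod>b\<in>Basis. LINT t|std_normal_distribution. g b t)"
    unfolding h_def by (intro prod.cong refl, subst integral_density) auto
  finally show ?thesis .
qed

lemma char_std_gaussian:
  fixes \<xi> :: "real ^ ('d::finite)"
  shows "(LINT x|std_gaussian. exp (\<i> * of_real (\<xi> \<bullet> x))) = of_real (exp (- (norm \<xi>)\<^sup>2 / 2))"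
proof -
  have "exp (\<i> * of_real (\<xi> \<bullet> x)) = (\<Prod>b\<in>Basis. exp (\<i> * of_real ((\<xi> \<bullet> b) * (x \<bullet> b))))" for x
    by (subst euclidean_inner) (simp add: sum_distrib_left exp_sum)
  then have "(LINT x|std_gaussian. exp (\<i> * of_real (\<xi> \<bullet> x))) =
      (\<Prod>b\<in>Basis. LINT t|std_normal_distribution. exp (\<i> * of_real ((\<xi> \<bullet> b) * t)))"
    by (simp only:) (rule integral_std_gaussian_prod, auto simp: norm_exp_i_times)
  also have "\<dots> = (\<Prod>b\<in>Basis. of_real (exp (- (\<xi> \<bullet> b)\<^sup>2 / 2)))"
    using char_std_normal_distribution by (simp add: char_def fun_eq_iff)
  also have "\<dots> = of_real (exp (- (norm \<xi>)\<^sup>2 / 2))"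
    by (subst euclidean_inner[of \<xi> \<xi>, folded power2_norm_eq_inner])
       (simp add: exp_sum sum_divide_distrib power2_eq_square flip: sum_negf of_real_prod)
  finally show ?thesis .
qed

lemma sets_std_gaussian [measurable_cong, simp]: "sets std_gaussian = sets borel"
  by (simp add: std_gaussian_def)

lemma borel_measurable_matrix_vector_mult:
  "(*v) (B :: real ^ ('d::finite) ^ 'd) \<in> borel_measurable std_gaussian"
  by (subst measurable_cong_sets[OF sets_std_gaussian refl])
     (intro borel_measurable_continuous_onI linear_continuous_on bounded_linear.linear matrix_vector_mul_bounded_linear)

lemma prob_space_centered_gaussian: "prob_space (centered_gaussian A)"
  unfolding centered_gaussian_def
  by (intro prob_space.prob_space_distr prob_space_std_gaussian borel_measurable_matrix_vector_mult)

text \<open>The chosen square root \<open>B\<close> enters only through the squared norm of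
  \<open>transpose B *v \<xi>\<close>, which is the quadratic form of \<open>A\<close>. Symmetry and
  semidefiniteness ensure that such a \<open>B\<close> exists.\<close>

lemma char_centered_gaussian:
  fixes A :: "real ^ ('d::finite) ^ 'd"
  assumes "transpose A = A" "\<And>x. x \<bullet> (A *v x) \<ge> 0"
  shows "(LINT y|centered_gaussian A. exp (\<i> * of_real (\<xi> \<bullet> y))) = of_real (exp (- (\<xi> \<bullet> (A *v \<xi>)) / 2))"
proof -
  define B where "B = (SOME B :: real ^ 'd ^ 'd. B ** transpose B = A)"
  have B: "B ** transpose B = A"
    unfolding B_def by (rule someI_ex) (rule positive_semidefinite_factor[OF assms])
  have "(LINT y|centered_gaussian A. exp (\<i> * of_real (\<xi> \<bullet> y))) =
      (LINT z|std_gaussian. exp (\<i> * of_real (\<xi> \<bullet> (B *v z))))"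
    unfolding centered_gaussian_def B_def[symmetric]
    by (subst integral_distr)
       (auto intro!: borel_measurable_matrix_vector_mult borel_measurable_continuous_onI continuous_intros)
  also have "\<dots> = (LINT z|std_gaussian. exp (\<i> * of_real ((transpose B *v \<xi>) \<bullet> z)))"
    by (simp add: dot_lmul_matrix[symmetric] transpose_matrix_vector)
  also have "\<dots> = of_real (exp (- (norm (transpose B *v \<xi>))\<^sup>2 / 2))"
    by (rule char_std_gaussian)
  also have "(norm (transpose B *v \<xi>))\<^sup>2 = \<xi> \<bullet> (A *v \<xi>)"
    unfolding power2_norm_eq_inner B[symmetric] matrix_vector_mul_assoc[symmetric]
    by (metis dot_lmul_matrix inner_commute transpose_matrix_vector)
  finally show ?thesis .
qed

subsection \<open>Weak convergence from convergence of characteristic functions on lattices\<close>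

text \<open>On a cube \<open>[-R, R]\<^sup>d\<close> every continuous function is a continuous function of the
  \<open>sin (y\<^sub>i / R)\<close>, hence uniformly close to a trigonometric polynomial with frequencies in a lattice.\<close>

inductive trig_polynomial :: "real \<Rightarrow> (real ^ ('d::finite) \<Rightarrow> complex) \<Rightarrow> bool" for \<theta> where
  monomial: "(\<And>i. \<xi> $ i \<in> \<int>) \<Longrightarrow> trig_polynomial \<theta> (\<lambda>y. c * exp (\<i> * of_real (\<theta> * (\<xi> \<bullet> y))))"
| add: "trig_polynomial \<theta> f \<Longrightarrow> trig_polynomial \<theta> g \<Longrightarrow> trig_polynomial \<theta> (\<lambda>y. f y + g y)"

lemma trig_polynomial_const: "trig_polynomial \<theta> (\<lambda>y. c)"
  using trig_polynomial.monomial[of 0 \<theta> c] by simp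

lemma trig_polynomial_mult:
  assumes "trig_polynomial \<theta> f" "trig_polynomial \<theta> g"
  shows "trig_polynomial \<theta> (\<lambda>y. f y * g y)"
  using assms
proof (induction f rule: trig_polynomial.induct)
  case (monomial \<xi> c)
  from monomial(2) show ?case
  proof (induction g rule: trig_polynomial.induct)
    case (monomial \<xi>' c')
    have "trig_polynomial \<theta> (\<lambda>y. (c * c') * exp (\<i> * of_real (\<theta> * ((\<xi> + \<xi>') \<bullet> y))))"
      by (rule trig_polynomial.monomial) (use monomial \<open>\<And>i. \<xi> $ i \<in> \<int>\<close> in auto)
    then show ?case
      by (simp add: inner_add_left algebra_simps exp_add)
  next
    case (add f g)
    then show ?case
      using trig_polynomial.add[of \<theta>] by (simp add: distrib_left)
  qed
next
  case (add f1 f2)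
  then show ?case
    using trig_polynomial.add[of \<theta>] by (simp add: distrib_right)
qed

lemma trig_polynomial_sum:
  assumes "\<And>i. i \<in> I \<Longrightarrow> trig_polynomial \<theta> (f i)"
  shows "trig_polynomial \<theta> (\<lambda>y. \<Sum>i\<in>I. f i y)"
  using assms
  by (induction I rule: infinite_finite_induct) (auto intro: trig_polynomial_const trig_polynomial.add)

lemma trig_polynomial_sin: "trig_polynomial \<theta> (\<lambda>y. of_real (sin (\<theta> * y $ i)))"
proof -
  have "trig_polynomial \<theta> (\<lambda>y. (1 / (2 * \<i>)) * exp (\<i> * of_real (\<theta> * (axis i 1 \<bullet> y)))
      + (- 1 / (2 * \<i>)) * exp (\<i> * of_real (\<theta> * (axis i (- 1) \<bullet> y))))"
    by (intro trig_polynomial.intros) (auto simp: axis_def)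
  also have "(\<lambda>y. (1 / (2 * \<i>)) * exp (\<i> * of_real (\<theta> * (axis i 1 \<bullet> y)))
      + (- 1 / (2 * \<i>)) * exp (\<i> * of_real (\<theta> * (axis i (- 1) \<bullet> y)))) = (\<lambda>y. of_real (sin (\<theta> * y $ i)))"
    by (intro ext) (simp add: inner_axis' sin_of_real[symmetric] sin_exp_eq field_simps)
  finally show ?thesis .
qed

text \<open>Real polynomial functions are generated from linear maps and constants by sums and
  products. Trigonometric polynomials are closed under both and contain the sines.\<close>

lemma trig_polynomial_real_polynomial_sin:
  fixes p :: "real ^ ('d::finite) \<Rightarrow> real"
  assumes "real_polynomial_function p"
  shows "trig_polynomial \<theta> (\<lambda>y. of_real (p (\<chi> i. sin (\<theta> * y $ i))))"
  using assms
proof (induction p rule: real_polynomial_function.induct)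
  case (linear p)
  then interpret bounded_linear p .
  have "p (\<chi> i. sin (\<theta> * y $ i)) = (\<Sum>i\<in>UNIV. sin (\<theta> * y $ i) * p (axis i 1))" for y
  proof -
    have "(\<chi> i. sin (\<theta> * y $ i)) = (\<Sum>i\<in>UNIV. sin (\<theta> * y $ i) *\<^sub>R axis i 1)"
      by (simp add: vec_eq_iff axis_def if_distrib[of "(*) _"] cong: if_cong)
    then show ?thesis
      by (simp add: sum scaleR)
  qed
  then show ?case
    by (simp only: of_real_sum of_real_mult)
       (intro trig_polynomial_sum trig_polynomial_mult trig_polynomial_sin trig_polynomial_const)
qed (simp_all add: trig_polynomial_const trig_polynomial.add trig_polynomial_mult)

lemma trig_polynomial_integrable:
  assumes "trig_polynomial \<theta> f" "prob_space N" "sets N = sets borel"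
  shows "integrable N f"
  using assms(1)
proof induction
  case (monomial \<xi> c)
  interpret prob_space N by fact
  show ?case
  proof (rule integrable_const_bound[of _ "norm c"])
    show "(\<lambda>y. c * exp (\<i> * of_real (\<theta> * (\<xi> \<bullet> y)))) \<in> borel_measurable N"
      by (subst measurable_cong_sets[OF assms(3) refl])
         (intro borel_measurable_continuous_onI continuous_intros)
  qed (simp add: norm_mult norm_exp_i_times flip: of_real_mult)
qed auto

lemma trig_polynomial_integral_tendsto:
  assumes "trig_polynomial \<theta> f" and D: "\<And>n. prob_space (D n)" "\<And>n. sets (D n) = sets borel"
    and N: "prob_space N" "sets N = sets borel"
    and char: "\<And>\<xi>. (\<And>i. \<xi> $ i \<in> \<int>) \<Longrightarrow>
      (\<lambda>n. LINT y|D n. exp (\<i> * of_real (\<theta> * (\<xi> \<bullet> y)))) \<longlonglongrightarrow> (LINT y|N. exp (\<i> * of_real (\<theta> * (\<xi> \<bullet> y))))"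
  shows "(\<lambda>n. LINT y|D n. f y) \<longlonglongrightarrow> (LINT y|N. f y)"
  using assms(1)
proof induction
  case (monomial \<xi> c)
  then show ?case
    by (simp only: integral_mult_right_zero) (intro tendsto_intros char)
next
  case (add f g)
  note int = trig_polynomial_integrable[OF add.hyps(1)] trig_polynomial_integrable[OF add.hyps(2)]
  show ?case
    using tendsto_add[OF add.IH] int D N by simp
qed

section \<open>Tightness and approximation on cubes\<close>

lemma open_cube_complement: "open {y :: real ^ ('d::finite). \<exists>i. R < \<bar>y $ i\<bar>}"
proof -
  have "open (\<Union>i. {y :: real ^ 'd. R < \<bar>y $ i\<bar>})"
    by (intro open_UN ballI open_Collect_less continuous_intros)
  moreover have "(\<Union>i. {y :: real ^ 'd. R < \<bar>y $ i\<bar>}) = {y. \<exists>i. R < \<bar>y $ i\<bar>}"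
    by auto
  ultimately show ?thesis
    by simp
qed

lemma cube_tight:
  fixes N :: "(real ^ ('d::finite)) measure"
  assumes "prob_space N" "sets N = sets borel" "\<epsilon> > 0"
  shows "\<exists>R. \<forall>R'\<ge>R. measure N {y. \<exists>i. R' < \<bar>y $ i\<bar>} \<le> \<epsilon>"
proof -
  interpret prob_space N by fact
  have meas: "{y :: real ^ 'd. \<exists>i. R < \<bar>y $ i\<bar>} \<in> sets N" for R
    by (simp add: assms(2) open_cube_complement)
  have "(\<lambda>n. measure N {y. \<exists>i. real n < \<bar>y $ i\<bar>}) \<longlonglongrightarrow> measure N (\<Inter>n. {y. \<exists>i. real n < \<bar>y $ i\<bar>})"
  proof (rule finite_Lim_measure_decseq)
    show "decseq (\<lambda>n. {y :: real ^ 'd. \<exists>i. real n < \<bar>y $ i\<bar>})"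
      unfolding decseq_def by clarsimp (meson le_less_trans of_nat_le_iff)
  qed (use meas in auto)
  moreover have "(\<Inter>n. {y :: real ^ 'd. \<exists>i. real n < \<bar>y $ i\<bar>}) = {}"
  proof -
    have "\<exists>n. \<forall>i. \<bar>y $ i\<bar> \<le> real n" for y :: "real ^ 'd"
    proof -
      obtain n where "norm y \<le> real n"
        using real_arch_simple by blast
      then show ?thesis
        using component_le_norm_cart order.trans by blast
    qed
    then show ?thesis
      by (fastforce simp: not_less[symmetric])
  qed
  ultimately have "(\<lambda>n. measure N {y. \<exists>i. real n < \<bar>y $ i\<bar>}) \<longlonglongrightarrow> 0"
    by simp
  from order_tendstoD(2)[OF this \<open>\<epsilon> > 0\<close>]
  obtain n where n: "measure N {y. \<exists>i. real n < \<bar>y $ i\<bar>} < \<epsilon>"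
    by (auto simp: eventually_sequentially)
  have "measure N {y. \<exists>i. R' < \<bar>y $ i\<bar>} \<le> \<epsilon>" if "R' \<ge> real n" for R'
    using that n
    by (intro order.trans[OF finite_measure_mono[OF _ meas[of "real n"]] less_imp_le[OF n]])
       (auto intro: order.strict_trans1)
  then show ?thesis
    by blast
qed

text \<open>The integrands differ by at most \<open>\<epsilon>\<close> on the cube; off the cube the
  cruder bound \<open>C\<close> is paid only on a set of mass at most
  \<open>\<epsilon>\<close>.\<close>

lemma integral_approx_on_cube:
  fixes N :: "(real ^ ('d::finite)) measure"
  assumes "prob_space N" "sets N = sets borel"
    and f: "integrable N f" and g: "integrable N g"
    and near: "\<And>y. (\<And>i. \<bar>y $ i\<bar> \<le> R) \<Longrightarrow> \<bar>f y - g y\<bar> \<le> \<epsilon>"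
    and far: "\<And>y. \<bar>f y - g y\<bar> \<le> C" and C: "C \<ge> 0" and e: "\<epsilon> \<ge> 0"
    and tight: "measure N {y. \<exists>i. R < \<bar>y $ i\<bar>} \<le> \<epsilon>"
  shows "\<bar>(LINT y|N. f y) - (LINT y|N. g y)\<bar> \<le> \<epsilon> * (1 + C)"
proof -
  interpret prob_space N by fact
  let ?B = "{y :: real ^ 'd. \<exists>i. R < \<bar>y $ i\<bar>}"
  have sp: "space N = UNIV"
    using sets_eq_imp_space_eq[OF assms(2)] by simp
  have B: "?B \<in> sets N"
    by (simp add: assms(2) open_cube_complement)
  have intB: "integrable N (\<lambda>y. C * indicator ?B y :: real)"
    using B by (intro integrable_mult_right integrable_real_indicator) (auto simp: less_top[symmetric])
  then have int: "integrable N (\<lambda>y. \<epsilon> + C * indicator ?B y)"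
    by simp
  have "\<bar>(LINT y|N. f y) - (LINT y|N. g y)\<bar> = \<bar>LINT y|N. f y - g y\<bar>"
    using f g by simp
  also have "\<dots> \<le> (LINT y|N. \<bar>f y - g y\<bar>)"
    using integral_norm_bound[of N "\<lambda>y. f y - g y"] by simp
  also have "\<dots> \<le> (LINT y|N. \<epsilon> + C * indicator ?B y)"
  proof (rule integral_mono)
    show "\<bar>f y - g y\<bar> \<le> \<epsilon> + C * indicator ?B y" for y
    proof (cases "y \<in> ?B")
      case True
      then show ?thesis
        using far[of y] e by simp
    next
      case False
      then show ?thesis
        using near[of y] by (auto simp: not_less)
    qed
  qed (use f g int in auto)
  also have "\<dots> = \<epsilon> + C * measure N ?B"
    using B sp by (subst Bochner_Integration.integral_add[OF _ intB]) (use prob_space in simp_all)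
  also have "\<dots> \<le> \<epsilon> * (1 + C)"
    using mult_left_mono[OF tight C] by (simp add: algebra_simps)
  finally show ?thesis .
qed

text \<open>Tightness restricts attention to a cube, where \<open>f\<close> is close to a
  trigonometric polynomial. Its frequency scale \<open>\<theta>\<close> shrinks as the cube grows,
  hence the assumption for all \<open>\<theta> > 0\<close>.\<close>

lemma weak_convergence_from_lattice_char:
  fixes D :: "nat \<Rightarrow> (real ^ ('d::finite)) measure"
  assumes D: "\<And>n. prob_space (D n)" "\<And>n. sets (D n) = sets borel"
    and N: "prob_space N" "sets N = sets borel"
    and tight: "\<And>\<epsilon>. \<epsilon> > 0 \<Longrightarrow> \<exists>R. \<forall>R'\<ge>R. \<forall>n. measure (D n) {y. \<exists>i. R' < \<bar>y $ i\<bar>} \<le> \<epsilon>"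
    and char: "\<And>\<theta> \<xi>. \<theta> > 0 \<Longrightarrow> (\<And>i. \<xi> $ i \<in> \<int>) \<Longrightarrow>
      (\<lambda>n. LINT y|D n. exp (\<i> * of_real (\<theta> * (\<xi> \<bullet> y)))) \<longlonglongrightarrow> (LINT y|N. exp (\<i> * of_real (\<theta> * (\<xi> \<bullet> y))))"
    and f: "continuous_on UNIV f" "bounded (range f)"
  shows "(\<lambda>n. LINT y|D n. f y) \<longlonglongrightarrow> (LINT y|N. f y :: real)"
proof (rule LIMSEQ_I)
  fix \<eta> :: real assume \<eta>: "\<eta> > 0"
  obtain K where K: "K > 0" "\<And>y. \<bar>f y\<bar> \<le> K"
    using f(2) by (auto simp: bounded_pos)
  define C where "C = 2 * K + 1"
  \<comment> \<open>Error budget: replacing \<open>f\<close> by \<open>g\<close> costs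
    \<open>\<eta> / 4\<close> under each of the two measures, which leaves \<open>\<eta> / 2\<close>
    for the convergence of the integrals of \<open>g\<close>.\<close>
  define \<epsilon> where "\<epsilon> = min 1 (\<eta> / (4 * (1 + C)))"
  have C: "C > 0"
    using K by (simp add: C_def)
  have "\<epsilon> * (1 + C) \<le> (\<eta> / (4 * (1 + C))) * (1 + C)"
    using C by (intro mult_right_mono) (auto simp: \<epsilon>_def)
  also have "\<dots> = \<eta> / 4"
    using C by (simp add: divide_simps)
  finally have \<epsilon>: "0 < \<epsilon>" "\<epsilon> \<le> 1" "\<epsilon> * (1 + C) \<le> \<eta> / 4"
    using C \<eta> by (auto simp: \<epsilon>_def)
  obtain R1 R2 where R1: "\<And>R' n. R' \<ge> R1 \<Longrightarrow> measure (D n) {y. \<exists>i. R' < \<bar>y $ i\<bar>} \<le> \<epsilon>"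
    and R2: "\<And>R'. R' \<ge> R2 \<Longrightarrow> measure N {y. \<exists>i. R' < \<bar>y $ i\<bar>} \<le> \<epsilon>"
    using tight[OF \<epsilon>(1)] cube_tight[OF N \<epsilon>(1)] by metis
  define R where "R = max 1 (max R1 R2)"
  have R: "R \<ge> 1" "R \<ge> R1" "R \<ge> R2"
    by (auto simp: R_def)
  \<comment> \<open>On the cube this scale keeps \<open>\<theta> * y $ i\<close> in
    \<open>[-1, 1]\<close>, where \<open>arcsin\<close> inverts \<open>sin\<close>; there
    \<open>h\<close> evaluated at the sines is \<open>f\<close> itself.\<close>
  define \<theta> where "\<theta> = 1 / R"
  have \<theta>: "\<theta> > 0"
    using R by (simp add: \<theta>_def)
  define S :: "(real ^ 'd) set" where "S = cbox (\<chi> i. -1) (\<chi> i. 1)"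
  define h where "h x = f (\<chi> i. R * arcsin (x $ i))" for x :: "real ^ 'd"
  have cont: "continuous_on S h"
    unfolding h_def
    by (rule continuous_on_compose2[OF f(1)])
       (auto intro!: continuous_intros simp: S_def mem_box_cart)
  obtain p where p: "real_polynomial_function p" "\<And>x. x \<in> S \<Longrightarrow> \<bar>h x - p x\<bar> < \<epsilon>"
    using Stone_Weierstrass_real_polynomial_function[OF _ cont \<epsilon>(1)] by (auto simp: S_def)
  define g where "g y = p (\<chi> i. sin (\<theta> * y $ i))" for y :: "real ^ 'd"
  have sinS: "(\<chi> i. sin (\<theta> * y $ i)) \<in> S" for y :: "real ^ 'd"
    by (simp add: S_def mem_box_cart)
  have trig: "trig_polynomial \<theta> (\<lambda>y. of_real (g y))"
    unfolding g_def by (rule trig_polynomial_real_polynomial_sin[OF p(1)])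
  have gint: "integrable Q g" if "prob_space Q" "sets Q = sets borel" for Q
    using integrable_Re[OF trig_polynomial_integrable[OF trig that]] by simp
  have fint: "integrable Q f" if "prob_space Q" "sets Q = sets borel" for Q
  proof -
    interpret prob_space Q by fact
    have "f \<in> borel_measurable Q"
      by (subst measurable_cong_sets[OF that(2) refl]) (intro borel_measurable_continuous_onI f)
    then show ?thesis
      using K by (intro integrable_const_bound[of _ K]) auto
  qed
  have near: "\<bar>f y - g y\<bar> \<le> \<epsilon>" if "\<And>i. \<bar>y $ i\<bar> \<le> R" for y
  proof -
    have "arcsin (sin (\<theta> * y $ i)) = \<theta> * y $ i" for i
    proof (rule arcsin_sin)
      have "\<bar>\<theta> * y $ i\<bar> \<le> 1"
        using that[of i] R by (simp add: \<theta>_def abs_mult field_simps)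
      then show "- (pi / 2) \<le> \<theta> * y $ i" "\<theta> * y $ i \<le> pi / 2"
        using pi_gt3 by linarith+
    qed
    then have "h (\<chi> i. sin (\<theta> * y $ i)) = f y"
      using R by (simp add: h_def \<theta>_def)
    then show ?thesis
      using p(2)[OF sinS[of y]] by (simp add: g_def)
  qed
  \<comment> \<open>This holds for all \<open>y\<close>, since the sine vector never leaves
    \<open>S\<close>: \<open>f\<close> and \<open>h\<close> are bounded by \<open>K\<close>, and
    \<open>p\<close> is within \<open>\<epsilon> \<le> 1\<close> of \<open>h\<close> on
    \<open>S\<close>.\<close>
  have far: "\<bar>f y - g y\<bar> \<le> C" for y
    using p(2)[OF sinS[of y]] K(2)[of y] K(2)[of "\<chi> i. R * arcsin ((\<chi> i. sin (\<theta> * y $ i)) $ i)"] \<epsilon>(2)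
    unfolding g_def h_def C_def by linarith
  have approx: "\<bar>(LINT y|Q. f y) - (LINT y|Q. g y)\<bar> \<le> \<eta> / 4"
    if "prob_space Q" "sets Q = sets borel" "measure Q {y. \<exists>i. R < \<bar>y $ i\<bar>} \<le> \<epsilon>" for Q
    using integral_approx_on_cube[OF that(1,2) fint gint near far _ _ that(3)] that \<epsilon> K
    by (auto simp: C_def)
  have "(\<lambda>n. LINT y|D n. complex_of_real (g y)) \<longlonglongrightarrow> (LINT y|N. complex_of_real (g y))"
    by (rule trig_polynomial_integral_tendsto[OF trig D N char[OF \<theta>]])
  then have "(\<lambda>n. LINT y|D n. g y) \<longlonglongrightarrow> (LINT y|N. g y)"
    by (simp add: tendsto_of_real_iff)
  from LIMSEQ_D[OF this, of "\<eta> / 2"] \<eta>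
  obtain n0 where n0: "\<And>n. n \<ge> n0 \<Longrightarrow> \<bar>(LINT y|D n. g y) - (LINT y|N. g y)\<bar> < \<eta> / 2"
    by auto
  have "\<bar>(LINT y|D n. f y) - (LINT y|N. f y)\<bar> < \<eta>" if "n \<ge> n0" for n
    using n0[OF that] approx[OF D R1[OF R(2)], of n] approx[OF N R2[OF R(3)]] by linarith
  then show "\<exists>n0. \<forall>n\<ge>n0. norm ((LINT y|D n. f y) - (LINT y|N. f y)) < \<eta>"
    by auto
qed

subsection \<open>From moment generating functions to characteristic functions\<close>

text \<open>If convergence failed at \<open>z\<close>, a subsequence would stay away from
  \<open>g z\<close>. Montel's theorem gives it a further subsequence with an entire limit, which
  agrees with \<open>g\<close> on the reals and so, by the identity theorem, everywhere.\<close>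

lemma Vitali_convergence_from_reals:
  fixes F :: "nat \<Rightarrow> complex \<Rightarrow> complex"
  assumes hol: "\<And>n. F n holomorphic_on UNIV" and g: "g holomorphic_on UNIV"
    and bd: "\<And>R. \<exists>B. \<forall>n z. cmod z \<le> R \<longrightarrow> cmod (F n z) \<le> B"
    and lim: "\<And>t. (\<lambda>n. F n (of_real t)) \<longlonglongrightarrow> g (of_real t)"
  shows "(\<lambda>n. F n z) \<longlonglongrightarrow> g z"
proof (rule ccontr)
  assume "\<not> (\<lambda>n. F n z) \<longlonglongrightarrow> g z"
  then obtain e where e: "e > 0" "\<not> (\<forall>\<^sub>F n in sequentially. dist (F n z) (g z) < e)"
    by (auto simp: tendsto_iff)
  then have "infinite {n. \<not> dist (F n z) (g z) < e}"
    by (simp add: eventually_sequentially not_eventually cofinite_eq_sequentially[symmetric]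
        frequently_cofinite)
  then obtain r where r: "strict_mono r" "\<And>n :: nat. \<not> dist (F (r n) z) (g z) < e"
    using infinite_enumerate by blast
  obtain h k where h: "h holomorphic_on UNIV" and k: "strict_mono (k :: nat \<Rightarrow> nat)"
    and conv: "\<And>x. x \<in> UNIV \<Longrightarrow> (\<lambda>n. F (r (k n)) x) \<longlonglongrightarrow> h x"
  proof (rule Montel[of UNIV "range F" "\<lambda>n. F (r n)"])
    show "\<exists>B. \<forall>h\<in>range F. \<forall>z\<in>K. cmod (h z) \<le> B" if K: "compact K" for K
    proof -
      obtain R where "\<And>z. z \<in> K \<Longrightarrow> cmod z \<le> R"
        using compact_imp_bounded[OF K] by (auto simp: bounded_iff)
      with bd[of R] show ?thesis
        by blast
    qed
  qed (use hol in auto)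
  have rk: "strict_mono (r \<circ> k)"
    using r k by (intro strict_mono_o)
  have real: "h (of_real t) = g (of_real t)" for t
    using LIMSEQ_unique[OF conv[of "of_real t"]] LIMSEQ_subseq_LIMSEQ[OF lim[of t] rk]
    by (simp add: o_def)
  have "(0 :: complex) islimpt range of_real"
    unfolding islimpt_approachable
  proof (intro allI impI)
    fix d :: real assume "d > 0"
    then show "\<exists>x'\<in>range of_real. x' \<noteq> (0 :: complex) \<and> dist x' 0 < d"
      by (intro bexI[OF _ rangeI[of _ "d / 2"]]) auto
  qed
  then have "h z - g z = 0"
    by (rule analytic_continuation[of "\<lambda>z. h z - g z" UNIV "range of_real", rotated 5])
       (use h g real in \<open>auto intro!: holomorphic_intros\<close>)
  then have "(\<lambda>n. F (r (k n)) z) \<longlonglongrightarrow> g z"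
    using conv[of z] by simp
  then have "\<forall>\<^sub>F n in sequentially. dist (F (r (k n)) z) (g z) < e"
    using e(1) by (rule tendstoD)
  then show False
    using r(2) by (auto simp: eventually_sequentially)
qed

subsection \<open>Bounded random vectors of natural numbers\<close>

locale nat_random_vector = prob_space P for P :: "'a measure" +
  fixes X :: "'a \<Rightarrow> nat ^ ('d::finite)"
  assumes bounded_X: "bounded_nat_random_vector P X"
begin

abbreviation "supp \<equiv> Poly_Mapping.keys (gen_poly P X)"
abbreviation "mass \<equiv> Poly_Mapping.lookup (gen_poly P X)"
abbreviation "\<mu> \<equiv> mean_vec P (\<lambda>\<omega>. real_vec (X \<omega>))"
abbreviation "\<Sigma> \<equiv> cov_mat P (\<lambda>\<omega>. real_vec (X \<omega>))"

lemma measurable_comp_X: "(\<lambda>\<omega>. g (X \<omega>)) \<in> borel_measurable P"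
proof (rule measurable_compose[of X P "count_space UNIV" g])
  show "X \<in> measurable P (count_space UNIV)"
    using bounded_X by (simp add: bounded_nat_random_vector_def)
qed simp

text \<open>A bounded \<open>X\<close> takes finitely many values, so \<open>g (X \<omega>)\<close>
  is a finite sum of indicators; vectors outside \<open>supp\<close> carry no mass. All expectations
  thereby become finite sums.\<close>

lemma has_bochner_integral_comp_X:
  fixes g :: "_ \<Rightarrow> 'b :: {banach, second_countable_topology}"
  shows "has_bochner_integral P (\<lambda>\<omega>. g (X \<omega>)) (\<Sum>r\<in>supp. mass r *\<^sub>R g r)"
proof -
  have X: "X \<in> measurable P (count_space UNIV)"
    using bounded_X by (simp add: bounded_nat_random_vector_def)
  obtain B where B: "\<And>\<omega>. \<omega> \<in> space P \<Longrightarrow> X \<omega> \<in> {r. \<forall>i. r $ i \<le> B}"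
    using bounded_X by (auto simp: bounded_nat_random_vector_def)
  let ?K = "{r :: nat ^ 'd. \<forall>i. r $ i \<le> B}"
  have mass: "mass r = prob {\<omega> \<in> space P. X \<omega> = r}" for r
    by (rule lookup_gen_poly[OF bounded_X])
  have sub: "supp \<subseteq> ?K"
  proof
    fix r assume "r \<in> supp"
    then have "{\<omega> \<in> space P. X \<omega> = r} \<noteq> {}"
      by (auto simp: in_keys_iff mass simp del: Collect_empty_eq)
    then show "r \<in> ?K"
      using B by auto
  qed
  have "has_bochner_integral P (\<lambda>\<omega>. \<Sum>r\<in>?K. indicator {\<omega> \<in> space P. X \<omega> = r} \<omega> *\<^sub>R g r)
      (\<Sum>r\<in>?K. prob {\<omega> \<in> space P. X \<omega> = r} *\<^sub>R g r)"
  proof (intro has_bochner_integral_sum has_bochner_integral_scaleR_left has_bochner_integral_real_indicator)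
    show "{\<omega> \<in> space P. X \<omega> = r} \<in> sets P" for r
      using measurable_sets[OF X, of "{r}"] by (simp add: vimage_def Int_def conj_commute)
  qed (auto simp: less_top[symmetric])
  also have "(\<Sum>r\<in>?K. prob {\<omega> \<in> space P. X \<omega> = r} *\<^sub>R g r) = (\<Sum>r\<in>supp. mass r *\<^sub>R g r)"
    unfolding mass[symmetric] using sub
    by (intro sum.mono_neutral_right finite_bounded_nat_vectors) (auto simp: in_keys_iff)
  finally show ?thesis
  proof (subst has_bochner_integral_cong[OF refl _ refl])
    fix \<omega> assume "\<omega> \<in> space P"
    then show "g (X \<omega>) = (\<Sum>r\<in>?K. indicator {\<omega> \<in> space P. X \<omega> = r} \<omega> *\<^sub>R g r)"
      using B[of \<omega>] finite_bounded_nat_vectors[of B]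
      by (subst sum.remove[of _ "X \<omega>"]) (auto simp: indicator_def intro!: sum.neutral)
  qed
qed

lemma integrable_comp_X: "integrable P (\<lambda>\<omega>. g (X \<omega>) :: 'b :: {banach, second_countable_topology})"
  by (rule integrable.intros[OF has_bochner_integral_comp_X])

lemma integral_comp_X:
  "(LINT \<omega>|P. g (X \<omega>)) = (\<Sum>r\<in>supp. mass r *\<^sub>R g r :: 'b :: {banach, second_countable_topology})"
  by (rule has_bochner_integral_integral_eq[OF has_bochner_integral_comp_X])

lemma mass_nonneg: "mass r \<ge> 0"
  by (simp add: lookup_gen_poly[OF bounded_X])

lemma mass_pos: "r \<in> supp \<Longrightarrow> mass r > 0"
  using mass_nonneg[of r] by (simp add: in_keys_iff less_le)

lemma sum_mass: "sum mass supp = 1"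
  using integral_comp_X[of "\<lambda>_. 1 :: real"] by (simp add: prob_space)

lemma supp_nonempty: "supp \<noteq> {}"
  using sum_mass by auto

lemma weighted_mean_mass: "weighted_mean supp mass \<phi> = (LINT \<omega>|P. \<phi> (X \<omega>))"
  by (simp add: weighted_mean_def sum_mass integral_comp_X)

lemma integral_inner: "(LINT \<omega>|P. \<xi> \<bullet> real_vec (X \<omega>)) = \<xi> \<bullet> \<mu>"
proof -
  have "(LINT \<omega>|P. \<xi> \<bullet> real_vec (X \<omega>)) = (LINT \<omega>|P. (\<Sum>i\<in>UNIV. \<xi> $ i * real_vec (X \<omega>) $ i))"
    by (simp add: inner_vec_def)
  also have "\<dots> = (\<Sum>i\<in>UNIV. \<xi> $ i * (LINT \<omega>|P. real_vec (X \<omega>) $ i))"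
    by (subst Bochner_Integration.integral_sum)
       (auto intro!: integrable_mult_right integrable_comp_X[of "\<lambda>r. real_vec r $ _"])
  finally show ?thesis
    by (simp add: inner_vec_def mean_vec_def)
qed

lemma cov_mat_quadratic: "\<xi> \<bullet> (\<Sigma> *v \<xi>) = (LINT \<omega>|P. (\<xi> \<bullet> (real_vec (X \<omega>) - \<mu>))\<^sup>2)"
proof -
  have int: "integrable P (\<lambda>\<omega>. (real_vec (X \<omega>) $ i - \<mu> $ i) * (real_vec (X \<omega>) $ j - \<mu> $ j))" for i j
    by (rule integrable_comp_X[of "\<lambda>r. (real_vec r $ i - \<mu> $ i) * (real_vec r $ j - \<mu> $ j)"])
  have "(LINT \<omega>|P. (\<xi> \<bullet> (real_vec (X \<omega>) - \<mu>))\<^sup>2) = (LINT \<omega>|P. (\<Sum>i\<in>UNIV. \<Sum>j\<in>UNIV.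
      \<xi> $ i * \<xi> $ j * ((real_vec (X \<omega>) $ i - \<mu> $ i) * (real_vec (X \<omega>) $ j - \<mu> $ j))))"
    by (simp add: inner_vec_def power2_eq_square sum_product algebra_simps)
  also have "\<dots> = (\<Sum>i\<in>UNIV. \<Sum>j\<in>UNIV.
      \<xi> $ i * \<xi> $ j * (LINT \<omega>|P. (real_vec (X \<omega>) $ i - \<mu> $ i) * (real_vec (X \<omega>) $ j - \<mu> $ j)))"
    by (simp add: Bochner_Integration.integral_sum Bochner_Integration.integrable_sum int)
  also have "\<dots> = \<xi> \<bullet> (\<Sigma> *v \<xi>)"
    unfolding inner_vec_def matrix_vector_mult_def cov_mat_def
    by (simp add: sum_distrib_left mult.assoc) (simp add: mult.commute)
  finally show ?thesis ..
qed

lemma variance_inner: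
  "weighted_mean supp mass (\<lambda>r. (\<xi> \<bullet> real_vec r)\<^sup>2) - (weighted_mean supp mass (\<lambda>r. \<xi> \<bullet> real_vec r))\<^sup>2
     = \<xi> \<bullet> (\<Sigma> *v \<xi>)"
proof -
  have "(\<xi> \<bullet> (real_vec r - \<mu>))\<^sup>2 = 1 * (\<xi> \<bullet> real_vec r)\<^sup>2 + (- 2 * (\<xi> \<bullet> \<mu>)) * ((\<xi> \<bullet> real_vec r) + (- (\<xi> \<bullet> \<mu>) / 2) * 1)" for r
    by (simp add: inner_diff_right power2_eq_square algebra_simps)
  then have "\<xi> \<bullet> (\<Sigma> *v \<xi>) = weighted_mean supp mass
      (\<lambda>r. 1 * (\<xi> \<bullet> real_vec r)\<^sup>2 + (- 2 * (\<xi> \<bullet> \<mu>)) * (1 * (\<xi> \<bullet> real_vec r) + (- (\<xi> \<bullet> \<mu>) / 2) * 1))"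
    unfolding cov_mat_quadratic by (simp add: weighted_mean_mass)
  also have "\<dots> = weighted_mean supp mass (\<lambda>r. (\<xi> \<bullet> real_vec r)\<^sup>2) - (\<xi> \<bullet> \<mu>)\<^sup>2"
    unfolding weighted_mean_linear
    by (simp add: weighted_mean_mass integral_inner prob_space power2_eq_square algebra_simps)
  finally show ?thesis
    by (simp add: weighted_mean_mass integral_inner)
qed

lemma cov_mat_symmetric: "transpose \<Sigma> = \<Sigma>"
  by (simp add: transpose_def cov_mat_def mult.commute)

lemma cov_mat_quadratic_nonneg: "\<xi> \<bullet> (\<Sigma> *v \<xi>) \<ge> 0"
  unfolding cov_mat_quadratic by simp

section \<open>Exponential moments and tails of the standardised vector\<close>

definition standardised :: "real \<Rightarrow> 'a \<Rightarrow> real ^ 'd" where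
  "standardised s \<omega> = (1 / s) *\<^sub>R (real_vec (X \<omega>) - \<mu>)"

text \<open>On the real axis this is the moment generating function of the component along
  \<open>\<xi>\<close>, on the imaginary axis its characteristic function.\<close>

definition cmgf :: "real \<Rightarrow> real ^ 'd \<Rightarrow> complex \<Rightarrow> complex" where
  "cmgf s \<xi> z = (LINT \<omega>|P. exp (z * of_real (\<xi> \<bullet> standardised s \<omega>)))"

lemma cmgf_eq_sum:
  "cmgf s \<xi> z = (\<Sum>r\<in>supp. of_real (mass r) * exp (z * of_real (\<xi> \<bullet> ((1 / s) *\<^sub>R (real_vec r - \<mu>)))))"
  unfolding cmgf_def standardised_def
  using integral_comp_X[of "\<lambda>r. exp (z * of_real (\<xi> \<bullet> ((1 / s) *\<^sub>R (real_vec r - \<mu>))))"]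
  by (simp add: scaleR_conv_of_real)

lemma cmgf_holomorphic: "cmgf s \<xi> holomorphic_on UNIV"
  unfolding cmgf_eq_sum[abs_def] by (intro holomorphic_intros)

lemma cmgf_of_real:
  "cmgf s \<xi> (of_real t) = of_real (\<Sum>r\<in>supp. mass r * exp (t * (\<xi> \<bullet> ((1 / s) *\<^sub>R (real_vec r - \<mu>)))))"
  unfolding cmgf_eq_sum by (simp flip: exp_of_real)

text \<open>Since \<open>exp (R * \<bar>c\<bar>) \<le> exp (R * c) + exp (- R * c)\<close>, two real
  points control a whole disc. This supplies the local boundedness needed for Montel's
  theorem.\<close>

lemma cmgf_bound:
  assumes "cmod z \<le> R"
  shows "cmod (cmgf s \<xi> z) \<le> cmod (cmgf s \<xi> (of_real R)) + cmod (cmgf s \<xi> (of_real (- R)))"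
proof -
  define c where "c r = \<xi> \<bullet> ((1 / s) *\<^sub>R (real_vec r - \<mu>))" for r
  have "cmod (exp (z * of_real (c r))) \<le> exp (R * c r) + exp (- R * c r)" for r
  proof -
    have "\<bar>Re z\<bar> \<le> R"
      using abs_Re_le_cmod[of z] assms by linarith
    then have "Re z * c r \<le> R * \<bar>c r\<bar>"
      using mult_right_mono[of "\<bar>Re z\<bar>" R "\<bar>c r\<bar>"] abs_ge_self[of "Re z * c r"]
      by (simp add: abs_mult)
    then have "exp (Re z * c r) \<le> exp (R * \<bar>c r\<bar>)"
      by simp
    also have "\<dots> \<le> exp (R * c r) + exp (- R * c r)"
      by (cases "c r \<ge> 0") auto
    finally show ?thesis
      by simp
  qed
  then have "cmod (cmgf s \<xi> z) \<le> (\<Sum>r\<in>supp. mass r * (exp (R * c r) + exp (- R * c r)))"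
    unfolding cmgf_eq_sum c_def[symmetric]
    by (intro order.trans[OF norm_sum] sum_mono)
       (simp add: norm_mult mass_nonneg mult_left_mono del: norm_exp_eq_Re)
  also have "\<dots> = cmod (cmgf s \<xi> (of_real R)) + cmod (cmgf s \<xi> (of_real (- R)))"
    unfolding cmgf_of_real c_def[symmetric] norm_of_real
    by (simp add: distrib_left sum.distrib sum_nonneg mass_nonneg)
  finally show ?thesis .
qed

text \<open>Centring removes the linear Taylor term, scaling turns the quadratic one into the scaled
  covariance, and the bound on all tilts controls the remainder.\<close>

lemma ln_cmgf_approx:
  assumes "s > 0"
    and C: "\<And>w. \<bar>third_central_moment supp (tilt (gen_poly P X) w) (\<lambda>r. \<xi> \<bullet> real_vec r)\<bar> \<le> C"
  shows "\<exists>u. cmgf s \<xi> (of_real t) = of_real (exp u) \<and>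
     \<bar>u - t\<^sup>2 / 2 * (\<xi> \<bullet> (((1 / s\<^sup>2) *\<^sub>R \<Sigma>) *v \<xi>))\<bar> \<le> \<bar>t\<bar> ^ 3 / 6 * (C / s ^ 3)"
proof -
  define \<phi> where "\<phi> r = \<xi> \<bullet> real_vec r" for r :: "nat ^ 'd"
  define W where "W x r = mass r * exp (x * \<phi> r)" for x r
  define a where "a = t / s"
  obtain x where x: "ln (sum (W a) supp) = ln (sum mass supp) + a * weighted_mean supp mass \<phi>
     + a\<^sup>2 / 2 * (weighted_mean supp mass (\<lambda>r. (\<phi> r)\<^sup>2) - (weighted_mean supp mass \<phi>)\<^sup>2)
     + a ^ 3 / 6 * third_central_moment supp (W x) \<phi>"
    using log_weighted_mgf_taylor[of supp mass a \<phi>] supp_nonempty mass_pos unfolding W_def by auto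
  have pos: "sum (W a) supp > 0"
    unfolding W_def using supp_nonempty mass_pos by (intro sum_pos) auto
  have mean: "weighted_mean supp mass \<phi> = \<xi> \<bullet> \<mu>"
    unfolding \<phi>_def by (simp add: weighted_mean_mass integral_inner)
  have var: "weighted_mean supp mass (\<lambda>r. (\<phi> r)\<^sup>2) - (weighted_mean supp mass \<phi>)\<^sup>2 = \<xi> \<bullet> (\<Sigma> *v \<xi>)"
    unfolding \<phi>_def by (rule variance_inner)
  define u where "u = ln (sum (W a) supp) - a * (\<xi> \<bullet> \<mu>)"
  have "exp u = sum (W a) supp * exp (- a * (\<xi> \<bullet> \<mu>))"
    using pos by (simp add: u_def exp_diff exp_minus field_simps)
  also have "\<dots> = (\<Sum>r\<in>supp. mass r * exp (t * (\<xi> \<bullet> ((1 / s) *\<^sub>R (real_vec r - \<mu>)))))"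
    by (simp add: W_def \<phi>_def a_def sum_distrib_right mult.assoc inner_diff_right diff_divide_distrib
        right_diff_distrib flip: exp_add)
  finally have "cmgf s \<xi> (of_real t) = of_real (exp u)"
    by (simp only: cmgf_of_real)
  moreover have "\<bar>u - t\<^sup>2 / 2 * (\<xi> \<bullet> (((1 / s\<^sup>2) *\<^sub>R \<Sigma>) *v \<xi>))\<bar> \<le> \<bar>t\<bar> ^ 3 / 6 * (C / s ^ 3)"
  proof -
    have "u - t\<^sup>2 / 2 * (\<xi> \<bullet> (((1 / s\<^sup>2) *\<^sub>R \<Sigma>) *v \<xi>)) = a ^ 3 / 6 * third_central_moment supp (W x) \<phi>"
      unfolding u_def x var unfolding mean sum_mass
      by (simp add: a_def power_divide scaleR_matrix_vector_assoc[symmetric])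
    \<comment> \<open>The intermediate point \<open>x\<close> is unknown, but its weights are again
      a tilt, in direction \<open>\<xi>\<close>, so the uniform bound applies.\<close>
    moreover have "W x = tilt (gen_poly P X) (x *\<^sub>R \<xi>)"
      by (simp add: W_def tilt_def \<phi>_def fun_eq_iff)
    then have "\<bar>third_central_moment supp (W x) \<phi>\<bar> \<le> C"
      using C by (simp add: \<phi>_def[abs_def])
    moreover have "\<bar>a ^ 3\<bar> = \<bar>t\<bar> ^ 3 / s ^ 3"
      using \<open>s > 0\<close> by (simp add: a_def power_divide power_abs)
    ultimately show ?thesis
      using \<open>s > 0\<close> mult_left_mono[of "\<bar>third_central_moment supp (W x) \<phi>\<bar>" C "\<bar>t\<bar> ^ 3 / s ^ 3 / 6"]
      by (simp only: abs_mult abs_divide) simp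
  qed
  ultimately show ?thesis
    by blast
qed

lemma standardised_measurable: "standardised s \<in> borel_measurable P"
  unfolding standardised_def[abs_def] by (rule measurable_comp_X)

lemma integral_distr_standardised:
  fixes g :: "real ^ 'd \<Rightarrow> 'b :: {banach, second_countable_topology}"
  assumes "continuous_on UNIV g"
  shows "(LINT y|distr P borel (standardised s). g y) = (LINT \<omega>|P. g (standardised s \<omega>))"
  by (intro integral_distr standardised_measurable borel_measurable_continuous_onI assms)

text \<open>Chebyshev's inequality for the squared Euclidean norm, whose expectation is the trace of
  the scaled covariance matrix.\<close>

lemma standardised_tail:
  assumes "R > 0"
  shows "measure (distr P borel (standardised s)) {y. \<exists>i. R < \<bar>y $ i\<bar>}
     \<le> (\<Sum>i\<in>UNIV. ((1 / s\<^sup>2) *\<^sub>R \<Sigma>) $ i $ i) / R\<^sup>2"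
proof -
  let ?B = "{y :: real ^ 'd. \<exists>i. R < \<bar>y $ i\<bar>}"
  have B: "?B \<in> sets borel"
    by (simp add: open_cube_complement)
  define Z where "Z r = (1 / s) *\<^sub>R (real_vec r - \<mu>)" for r :: "nat ^ 'd"
  have st: "standardised s = (\<lambda>\<omega>. Z (X \<omega>))"
    by (simp add: standardised_def Z_def fun_eq_iff)
  have "measure (distr P borel (standardised s)) ?B = (LINT y|distr P borel (standardised s). indicator ?B y)"
    using B by simp
  also have "\<dots> = (LINT \<omega>|P. indicator ?B (Z (X \<omega>)))"
    using B by (subst integral_distr[OF standardised_measurable]) (auto simp: st)
  also have "\<dots> \<le> (LINT \<omega>|P. (\<Sum>i\<in>UNIV. (Z (X \<omega>) $ i)\<^sup>2) / R\<^sup>2)"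
  proof (rule integral_mono)
    fix \<omega>
    show "indicator ?B (Z (X \<omega>)) \<le> (\<Sum>i\<in>UNIV. (Z (X \<omega>) $ i)\<^sup>2) / R\<^sup>2"
    proof (cases "Z (X \<omega>) \<in> ?B")
      case True
      then obtain i where "R < \<bar>Z (X \<omega>) $ i\<bar>"
        by auto
      then have "R\<^sup>2 \<le> (Z (X \<omega>) $ i)\<^sup>2"
        using assms by (metis abs_of_pos less_imp_le power2_le_iff_abs_le abs_le_square_iff)
      also have "\<dots> \<le> (\<Sum>i\<in>UNIV. (Z (X \<omega>) $ i)\<^sup>2)"
        by (rule member_le_sum) auto
      finally show ?thesis
        using True assms by simp
    qed (simp add: sum_nonneg)
  qed (rule integrable_comp_X)+
  also have "\<dots> = (\<Sum>i\<in>UNIV. (LINT \<omega>|P. (Z (X \<omega>) $ i)\<^sup>2)) / R\<^sup>2"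
    by (simp add: Bochner_Integration.integral_sum integrable_comp_X[of "\<lambda>r. (Z r $ _)\<^sup>2"])
  also have "(\<lambda>i. LINT \<omega>|P. (Z (X \<omega>) $ i)\<^sup>2) = (\<lambda>i. ((1 / s\<^sup>2) *\<^sub>R \<Sigma>) $ i $ i)"
    by (simp add: Z_def cov_mat_def power_mult_distrib power_divide power2_eq_square[of "_ - _"] fun_eq_iff)
  finally show ?thesis .
qed

end

subsection \<open>The central limit theorem\<close>

lemma central_limit_real_stable:
  fixes P :: "nat \<Rightarrow> 'a measure"
    and X :: "nat \<Rightarrow> 'a \<Rightarrow> nat ^ ('d::finite)"
    and f :: "real ^ 'd \<Rightarrow> real"
  assumes prob: "\<And>n. prob_space (P n)"
    and bounded: "\<And>n. bounded_nat_random_vector (P n) (X n)"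
    and stable: "\<And>n. real_stable (gen_poly (P n) (X n))"
    and degree: "\<And>n i. degree_in i (gen_poly (P n) (X n)) \<le> M n"
    and s: "\<And>n. s n > 0"
    and cov: "(\<lambda>n. (1 / (s n)\<^sup>2) *\<^sub>R cov_mat (P n) (\<lambda>\<omega>. real_vec (X n \<omega>))) \<longlonglongrightarrow> A"
    and M: "(\<lambda>n. root 3 (real (M n)) / s n) \<longlonglongrightarrow> 0"
    and f: "continuous_on UNIV f" "bounded (range f)"
  shows "(\<lambda>n. LINT \<omega>|P n. f ((1 / s n) *\<^sub>R
      (real_vec (X n \<omega>) - mean_vec (P n) (\<lambda>\<omega>. real_vec (X n \<omega>))))) \<longlonglongrightarrow> (LINT y|centered_gaussian A. f y)"
proof -
  interpret nat_random_vector "P n" "X n" for n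
    using prob bounded by (simp add: nat_random_vector_def nat_random_vector_axioms_def)
  define S where "S n = (1 / (s n)\<^sup>2) *\<^sub>R cov_mat (P n) (\<lambda>\<omega>. real_vec (X n \<omega>))" for n
  have S: "(\<lambda>n. S n $ i $ j) \<longlonglongrightarrow> A $ i $ j" for i j
    using tendsto_vec_nth[OF tendsto_vec_nth[OF cov, of i], of j] by (simp add: S_def)
  have quad: "(\<lambda>n. \<xi> \<bullet> (S n *v \<xi>)) \<longlonglongrightarrow> \<xi> \<bullet> (A *v \<xi>)" for \<xi>
    unfolding inner_vec_def matrix_vector_mult_def inner_real_def vec_lambda_beta
    by (intro tendsto_intros S)
  have sym: "transpose A = A"
  proof -
    have "S n $ i $ j = S n $ j $ i" for n i j
      using cov_mat_symmetric[of n] by (simp add: S_def transpose_def vec_eq_iff)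
    then have "A $ i $ j = A $ j $ i" for i j
      using LIMSEQ_unique[OF S[of i j]] S[of j i] by simp
    then show ?thesis
      by (simp add: transpose_def vec_eq_iff)
  qed
  have psd: "\<xi> \<bullet> (A *v \<xi>) \<ge> 0" for \<xi>
  proof (rule LIMSEQ_le_const[OF quad])
    show "\<exists>N. \<forall>n\<ge>N. 0 \<le> \<xi> \<bullet> (S n *v \<xi>)"
      using cov_mat_quadratic_nonneg by (simp add: S_def scaleR_matrix_vector_assoc[symmetric])
  qed
  have M3: "(\<lambda>n. real (M n) / s n ^ 3) \<longlonglongrightarrow> 0"
    using tendsto_power[OF M, of 3] by (simp add: power_divide)
  have mgf: "(\<lambda>n. cmgf n (s n) (int_vec m) (of_real t)) \<longlonglongrightarrow> of_real (exp (t\<^sup>2 / 2 * (int_vec m \<bullet> (A *v int_vec m))))"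
    for m t
  proof -
    have nz: "gen_poly (P n) (X n) \<noteq> 0" for n
      using supp_nonempty[of n] by auto
    \<comment> \<open>\<open>C\<close> depends on \<open>m\<close> alone and serves all
      \<open>n\<close> and all tilts at once. This is where stability and the degree bounds
      enter.\<close>
    have "\<exists>C. \<forall>n w. \<bar>third_central_moment (Poly_Mapping.keys (gen_poly (P n) (X n)))
        (tilt (gen_poly (P n) (X n)) w) (\<lambda>r. int_vec m \<bullet> real_vec r)\<bar> \<le> C * real (M n)"
    proof (rule third_central_moment_tilt_int_le[of m], intro exI allI)
      fix C n w
      assume "\<And>f k w. \<lbrakk>real_stable f; \<And>r. Poly_Mapping.lookup f r \<ge> 0; f \<noteq> 0;
        \<And>i. degree_in i f \<le> k\<rbrakk> \<Longrightarrow>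
        \<bar>third_central_moment (Poly_Mapping.keys f) (tilt f w) (\<lambda>r. int_vec m \<bullet> real_vec r)\<bar> \<le> C * real k"
      from this[OF stable mass_nonneg nz degree]
      show "\<bar>third_central_moment (Poly_Mapping.keys (gen_poly (P n) (X n)))
        (tilt (gen_poly (P n) (X n)) w) (\<lambda>r. int_vec m \<bullet> real_vec r)\<bar> \<le> C * real (M n)"
        .
    qed
    then obtain C where C: "\<And>n w. \<bar>third_central_moment (Poly_Mapping.keys (gen_poly (P n) (X n)))
        (tilt (gen_poly (P n) (X n)) w) (\<lambda>r. int_vec m \<bullet> real_vec r)\<bar> \<le> C * real (M n)"
      by blast
    have "\<exists>u. cmgf n (s n) (int_vec m) (of_real t) = of_real (exp u) \<and>
     \<bar>u - t\<^sup>2 / 2 * (int_vec m \<bullet> (S n *v int_vec m))\<bar> \<le> \<bar>t\<bar> ^ 3 / 6 * ((C * real (M n)) / s n ^ 3)" for n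
      unfolding S_def by (intro ln_cmgf_approx s C)
    then obtain u where u: "\<And>n. cmgf n (s n) (int_vec m) (of_real t) = of_real (exp (u n))"
      "\<And>n. \<bar>u n - t\<^sup>2 / 2 * (int_vec m \<bullet> (S n *v int_vec m))\<bar> \<le> \<bar>t\<bar> ^ 3 / 6 * ((C * real (M n)) / s n ^ 3)"
      by metis
    have "(\<lambda>n. \<bar>t\<bar> ^ 3 / 6 * ((C * real (M n)) / s n ^ 3)) \<longlonglongrightarrow> 0"
      using tendsto_mult_right_zero[OF M3, of "\<bar>t\<bar> ^ 3 / 6 * C"] by (simp add: mult_ac)
    then have "(\<lambda>n. u n - t\<^sup>2 / 2 * (int_vec m \<bullet> (S n *v int_vec m))) \<longlonglongrightarrow> 0"
      by (rule Lim_null_comparison[rotated]) (use u(2) in auto)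
    from tendsto_add[OF this tendsto_mult_left[OF quad, of "t\<^sup>2 / 2" "int_vec m"]]
    have "u \<longlonglongrightarrow> t\<^sup>2 / 2 * (int_vec m \<bullet> (A *v int_vec m))"
      by simp
    then show ?thesis
      unfolding u by (intro tendsto_intros)
  qed
  \<comment> \<open>Convergence at \<open>R\<close> and \<open>-R\<close> makes the transforms
    uniformly bounded on each disc, so the limit on the real axis extends to complex
    arguments.\<close>
  have char: "(\<lambda>n. cmgf n (s n) (int_vec m) z) \<longlonglongrightarrow> exp (z\<^sup>2 / 2 * of_real (int_vec m \<bullet> (A *v int_vec m)))"
    for m z
  proof (rule Vitali_convergence_from_reals[where F = "\<lambda>n. cmgf n (s n) (int_vec m)"
        and g = "\<lambda>z. exp (z\<^sup>2 / 2 * of_real (int_vec m \<bullet> (A *v int_vec m)))"])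
    show "\<exists>B. \<forall>n z. cmod z \<le> R \<longrightarrow> cmod (cmgf n (s n) (int_vec m) z) \<le> B" for R
    proof -
      have "Bseq (\<lambda>n. cmgf n (s n) (int_vec m) (of_real R'))" for R'
        using mgf by (intro convergent_imp_Bseq convergentI)
      from this[of R] this[of "- R"] obtain B1 B2 where
        "\<And>n. cmod (cmgf n (s n) (int_vec m) (of_real R)) \<le> B1"
        "\<And>n. cmod (cmgf n (s n) (int_vec m) (of_real (- R))) \<le> B2"
        by (auto simp: Bseq_def)
      then have "cmod (cmgf n (s n) (int_vec m) z) \<le> B1 + B2" if "cmod z \<le> R" for n z
        using cmgf_bound[OF that, of n "s n" "int_vec m"] by (meson add_mono order.trans)
      then show ?thesis
        by blast
    qed
    show "(\<lambda>n. cmgf n (s n) (int_vec m) (of_real t)) \<longlonglongrightarrow>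
        exp ((of_real t)\<^sup>2 / 2 * of_real (int_vec m \<bullet> (A *v int_vec m)))" for t
      using mgf[of m t] by (simp flip: exp_of_real)
  qed (auto intro!: cmgf_holomorphic holomorphic_intros)
  define D where "D n = distr (P n) borel (standardised n (s n))" for n
  have D: "prob_space (D n)" "sets (D n) = sets borel" for n
    unfolding D_def using prob_space_distr[OF standardised_measurable] by auto
  have "(\<lambda>n. LINT y|D n. f y) \<longlonglongrightarrow> (LINT y|centered_gaussian A. f y)"
  proof (rule weak_convergence_from_lattice_char[OF D prob_space_centered_gaussian _ _ _ f])
    show "sets (centered_gaussian A) = sets borel"
      by (simp add: centered_gaussian_def)
  next
    fix \<epsilon> :: real assume \<epsilon>: "\<epsilon> > 0"
    have "Bseq (\<lambda>n. \<Sum>i\<in>UNIV. S n $ i $ i)"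
      using S by (intro convergent_imp_Bseq convergentI[OF tendsto_sum])
    then obtain B where B: "B > 0" "\<And>n. \<bar>\<Sum>i\<in>UNIV. S n $ i $ i\<bar> \<le> B"
      by (auto simp: Bseq_def)
    \<comment> \<open>\<open>B\<close> bounds the traces of the scaled covariances, which converge.
      The threshold 1 lets \<open>R\<close> replace its square in the Chebyshev bound, and
      \<open>B / \<epsilon>\<close> then suffices.\<close>
    have "measure (D n) {y. \<exists>i. R < \<bar>y $ i\<bar>} \<le> \<epsilon>" if R: "R \<ge> max 1 (B / \<epsilon>)" for n R
    proof -
      have "measure (D n) {y. \<exists>i. R < \<bar>y $ i\<bar>} \<le> (\<Sum>i\<in>UNIV. S n $ i $ i) / R\<^sup>2"
        unfolding D_def S_def using R by (intro standardised_tail) auto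
      also have "\<dots> \<le> B / R\<^sup>2"
        using B(2)[of n] by (intro divide_right_mono) auto
      also have "\<dots> \<le> B / R"
        using B(1) R self_le_power[of R 2] by (intro divide_left_mono) auto
      also have "\<dots> \<le> \<epsilon>"
        using R \<epsilon> by (simp add: field_simps)
      finally show ?thesis .
    qed
    then show "\<exists>R. \<forall>R'\<ge>R. \<forall>n. measure (D n) {y. \<exists>i. R' < \<bar>y $ i\<bar>} \<le> \<epsilon>"
      by blast
  next
    fix \<theta> :: real and \<xi> :: "real ^ 'd" assume "\<And>i. \<xi> $ i \<in> \<int>"
    then have "\<forall>i. \<exists>k. \<xi> $ i = of_int k"
      by (auto elim: Ints_cases)
    then obtain k where "\<And>i. \<xi> $ i = of_int (k i)"
      by metis
    then have \<xi>: "\<xi> = int_vec (\<chi> i. k i)"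
      by (simp add: int_vec_def vec_eq_iff)
    \<comment> \<open>At the point \<open>\<i> * of_real \<theta>\<close> the transform is the
      characteristic function, and the limiting exponent \<open>z\<^sup>2 / 2\<close> changes sign
      to the Gaussian one.\<close>
    have "(LINT y|D n. exp (\<i> * of_real (\<theta> * (\<xi> \<bullet> y)))) = cmgf n (s n) \<xi> (\<i> * of_real \<theta>)" for n
      unfolding D_def by (subst integral_distr_standardised) (auto intro!: continuous_intros simp: cmgf_def mult.assoc)
    moreover have "(LINT y|centered_gaussian A. exp (\<i> * of_real (\<theta> * (\<xi> \<bullet> y)))) =
        exp ((\<i> * of_real \<theta>)\<^sup>2 / 2 * of_real (\<xi> \<bullet> (A *v \<xi>)))"
      using char_centered_gaussian[OF sym psd, of "\<theta> *\<^sub>R \<xi>"]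
      by (simp add: matrix_vector_mult_scaleR power_mult_distrib power2_eq_square[of \<theta>]
          power2_eq_square[of "complex_of_real \<theta>"] mult.assoc flip: exp_of_real)
    ultimately show "(\<lambda>n. LINT y|D n. exp (\<i> * of_real (\<theta> * (\<xi> \<bullet> y))))
        \<longlonglongrightarrow> (LINT y|centered_gaussian A. exp (\<i> * of_real (\<theta> * (\<xi> \<bullet> y))))"
      using char[of "\<chi> i. k i" "\<i> * of_real \<theta>"] by (simp only: \<xi>)
  qed
  then show ?thesis
    by (simp add: D_def integral_distr_standardised[OF f(1)] standardised_def)
qed

theorem theorem2p1:
  fixes P :: "nat \<Rightarrow> 'a measure"
    and X :: "nat \<Rightarrow> 'a \<Rightarrow> nat ^ ('d::finite)"
    and M :: "nat \<Rightarrow> nat"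
    and s :: "nat \<Rightarrow> real"
    and A :: "real ^ 'd ^ 'd"
  assumes "\<And>n. n \<ge> 1 \<Longrightarrow> prob_space (P n)"
    and "\<And>n. n \<ge> 1 \<Longrightarrow> bounded_nat_random_vector (P n) (X n)"
    and "\<And>n. n \<ge> 1 \<Longrightarrow> real_stable (gen_poly (P n) (X n))"
    and "\<And>n i. n \<ge> 1 \<Longrightarrow> degree_in i (gen_poly (P n) (X n)) \<le> M n"
    and "filterlim s at_top sequentially"
    and "(\<lambda>n. (1 / (s n)\<^sup>2) *\<^sub>R cov_mat (P n) (\<lambda>\<omega>. real_vec (X n \<omega>))) \<longlonglongrightarrow> A"
    and "(\<lambda>n. root 3 (real (M n)) / s n) \<longlonglongrightarrow> 0"
  shows "converges_in_distribution P
     (\<lambda>n \<omega>. (1 / s n) *\<^sub>R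
        (real_vec (X n \<omega>) - mean_vec (P n) (\<lambda>\<omega>. real_vec (X n \<omega>))))
     (centered_gaussian A)"
  unfolding converges_in_distribution_def
proof (intro allI impI)
  fix f :: "real ^ 'd \<Rightarrow> real"
  assume f: "continuous_on UNIV f" "bounded (range f)"
  have "\<forall>\<^sub>F n in sequentially. s n > 0"
    using assms(5) by (simp add: filterlim_at_top_dense)
  then obtain n0 where n0: "\<And>n. n \<ge> n0 \<Longrightarrow> s n > 0"
    by (auto simp: eventually_sequentially)
  \<comment> \<open>Shifting by \<open>n0\<close> makes \<open>s\<close> positive at every index;
    the extra 1 keeps all indices at least 1, where the hypotheses are available.\<close>
  define N where "N = n0 + 1"
  show "(\<lambda>n. LINT \<omega>|P n. f ((1 / s n) *\<^sub>R
      (real_vec (X n \<omega>) - mean_vec (P n) (\<lambda>\<omega>. real_vec (X n \<omega>))))) \<longlonglongrightarrow> (LINT y|centered_gaussian A. f y)"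
  proof (rule LIMSEQ_offset[where k = N], rule central_limit_real_stable)
    show "(\<lambda>n. (1 / (s (n + N))\<^sup>2) *\<^sub>R cov_mat (P (n + N)) (\<lambda>\<omega>. real_vec (X (n + N) \<omega>))) \<longlonglongrightarrow> A"
      using assms(6) by (rule LIMSEQ_ignore_initial_segment)
    show "(\<lambda>n. root 3 (real (M (n + N))) / s (n + N)) \<longlonglongrightarrow> 0"
      using assms(7) by (rule LIMSEQ_ignore_initial_segment)
  qed (use assms(1-4) n0 f in \<open>auto simp: N_def\<close>)
qed

end
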